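(* Let $T$ be a t-minimal theory, $\mathbb{M}$ a monster model, $(G,+)$ a definable abelian group with canonical topology $\tau$. If $|G|>1$, then $\tau$ is non-trivial: there is a $\tau$-open set other than $\emptyset$ and $G$.
   Context: A complete one-sorted theory $T$ is t-minimal if there is a Hausdorff topology on models $M$ of $T$ (on $M^1$) with a basis given by a definable family, such that every definable $D\subseteq M$ has non-empty interior iff $D$ is infinite. "Definable" means definable with parameters; $\mathbb{M}^n$ has the product topology. For definable $X\subseteq\mathbb{M}^n$, $\dim(X)=-\infty$ if $X=\emptyset$, and otherwise the largest $k$ such that some coordinate projection $\pi:\mathbb{M}^n\to\mathbb{M}^k$ has $\pi(X)$ with non-empty interior. For a definable abelian group $G$, a definable $X\subseteq G$ is big if $\dim(X)=\dim(G)$; the canonical topology on $G$ is the group topology for which the sets $X-X=\{x-y:x,y\in X\}$ with $X$ big definable form a neighborhood basis of $0$. *)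

theory Defs
  imports "HOL-Analysis.Analysis" "HOL-Algebra.Group"
begin

unbundle cardinal_syntax

section \<open>One-sorted first-order logic\<close>

record ('f, 'r) language =
  fsyms :: "'f set"
  farity :: "'f \<Rightarrow> nat"
  rsyms :: "'r set"
  rarity :: "'r \<Rightarrow> nat"

datatype 'f trm = Var nat | App 'f "'f trm list"

datatype ('f, 'r) fm =
    Eq "'f trm" "'f trm"
  | Rel 'r "'f trm list"
  | Neg "('f, 'r) fm"
  | Conj "('f, 'r) fm" "('f, 'r) fm"
  | Exists nat "('f, 'r) fm"

fun wf_trm :: "('f, 'r) language \<Rightarrow> 'f trm \<Rightarrow> bool" where
  "wf_trm L (Var i) \<longleftrightarrow> True"
| "wf_trm L (App f ts) \<longleftrightarrow> f \<in> fsyms L \<and> length ts = farity L f \<and> (\<forall>t\<in>set ts. wf_trm L t)"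

fun wf_fm :: "('f, 'r) language \<Rightarrow> ('f, 'r) fm \<Rightarrow> bool" where
  "wf_fm L (Eq s t) \<longleftrightarrow> wf_trm L s \<and> wf_trm L t"
| "wf_fm L (Rel r ts) \<longleftrightarrow> r \<in> rsyms L \<and> length ts = rarity L r \<and> (\<forall>t\<in>set ts. wf_trm L t)"
| "wf_fm L (Neg \<phi>) \<longleftrightarrow> wf_fm L \<phi>"
| "wf_fm L (Conj \<phi> \<psi>) \<longleftrightarrow> wf_fm L \<phi> \<and> wf_fm L \<psi>"
| "wf_fm L (Exists i \<phi>) \<longleftrightarrow> wf_fm L \<phi>"

definition formulas :: "('f, 'r) language \<Rightarrow> ('f, 'r) fm set" where
  "formulas L = {\<phi>. wf_fm L \<phi>}"

fun fv_trm :: "'f trm \<Rightarrow> nat set" where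
  "fv_trm (Var i) = {i}"
| "fv_trm (App f ts) = (\<Union>t\<in>set ts. fv_trm t)"

fun fv :: "('f, 'r) fm \<Rightarrow> nat set" where
  "fv (Eq s t) = fv_trm s \<union> fv_trm t"
| "fv (Rel r ts) = (\<Union>t\<in>set ts. fv_trm t)"
| "fv (Neg \<phi>) = fv \<phi>"
| "fv (Conj \<phi> \<psi>) = fv \<phi> \<union> fv \<psi>"
| "fv (Exists i \<phi>) = fv \<phi> - {i}"

definition sentences :: "('f, 'r) language \<Rightarrow> ('f, 'r) fm set" where
  "sentences L = {\<phi> \<in> formulas L. fv \<phi> = {}}"

record ('a, 'f, 'r) fo_struct = "'a partial_object" +
  fint :: "'f \<Rightarrow> 'a list \<Rightarrow> 'a"
  rint :: "'r \<Rightarrow> 'a list \<Rightarrow> bool"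

definition is_structure :: "('f, 'r) language \<Rightarrow> ('a, 'f, 'r) fo_struct \<Rightarrow> bool" where
  "is_structure L M \<longleftrightarrow> carrier M \<noteq> {} \<and>
     (\<forall>f\<in>fsyms L. \<forall>xs. set xs \<subseteq> carrier M \<and> length xs = farity L f \<longrightarrow> fint M f xs \<in> carrier M)"

fun trm_val :: "('a, 'f, 'r) fo_struct \<Rightarrow> (nat \<Rightarrow> 'a) \<Rightarrow> 'f trm \<Rightarrow> 'a" where
  "trm_val M e (Var i) = e i"
| "trm_val M e (App f ts) = fint M f (map (trm_val M e) ts)"

fun sat :: "('a, 'f, 'r) fo_struct \<Rightarrow> (nat \<Rightarrow> 'a) \<Rightarrow> ('f, 'r) fm \<Rightarrow> bool" where
  "sat M e (Eq s t) \<longleftrightarrow> trm_val M e s = trm_val M e t"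
| "sat M e (Rel r ts) \<longleftrightarrow> rint M r (map (trm_val M e) ts)"
| "sat M e (Neg \<phi>) \<longleftrightarrow> \<not> sat M e \<phi>"
| "sat M e (Conj \<phi> \<psi>) \<longleftrightarrow> sat M e \<phi> \<and> sat M e \<psi>"
| "sat M e (Exists i \<phi>) \<longleftrightarrow> (\<exists>a\<in>carrier M. sat M (e(i := a)) \<phi>)"

definition holds :: "('a, 'f, 'r) fo_struct \<Rightarrow> ('f, 'r) fm \<Rightarrow> bool" where
  "holds M \<phi> \<longleftrightarrow> (\<forall>e. range e \<subseteq> carrier M \<longrightarrow> sat M e \<phi>)"

definition is_model ::
    "('f, 'r) language \<Rightarrow> ('f, 'r) fm set \<Rightarrow> ('a, 'f, 'r) fo_struct \<Rightarrow> bool" where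
  "is_model L T M \<longleftrightarrow> is_structure L M \<and> (\<forall>\<phi>\<in>T. holds M \<phi>)"

text \<open>
  HOL cannot quantify over all types inside a formula, so consistency and entailment refer to the
  models of T whose universe is a set of elements of a given type. If that type contains the
  universe of an infinite model of cardinality at least the number of formulas, the
  Loewenheim-Skolem theorem shows that this is no restriction.
\<close>

definition complete_theory ::
    "'a itself \<Rightarrow> ('f, 'r) language \<Rightarrow> ('f, 'r) fm set \<Rightarrow> bool" where
  "complete_theory _ L T \<longleftrightarrow> T \<subseteq> sentences L \<and>
     (\<exists>M :: ('a, 'f, 'r) fo_struct. is_model L T M) \<and>
     (\<forall>\<phi>\<in>sentences L.
        (\<forall>M :: ('a, 'f, 'r) fo_struct. is_model L T M \<longrightarrow> holds M \<phi>) \<or>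
        (\<forall>M :: ('a, 'f, 'r) fo_struct. is_model L T M \<longrightarrow> holds M (Neg \<phi>)))"


section \<open>Monster models\<close>

text \<open>
  A pair (\<open>\<phi>\<close>, \<open>e\<close>) stands for the formula \<open>\<phi>\<close> in the variable 0 whose other free variables \<open>i\<close> are
  replaced by the parameters \<open>e i\<close>.
\<close>

definition saturated ::
    "('f, 'r) language \<Rightarrow> 'k rel \<Rightarrow> ('a, 'f, 'r) fo_struct \<Rightarrow> bool" where
  "saturated L \<kappa> M \<longleftrightarrow>
     (\<forall>A p. A \<subseteq> carrier M \<and> |A| <o \<kappa> \<and>
        (\<forall>(\<phi>, e)\<in>p. \<phi> \<in> formulas L \<and> e ` (fv \<phi> - {0}) \<subseteq> A) \<and>
        (\<forall>q. finite q \<and> q \<subseteq> p \<longrightarrow> (\<exists>a\<in>carrier M. \<forall>(\<phi>, e)\<in>q. sat M (e(0 := a)) \<phi>)) \<longrightarrow>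
        (\<exists>a\<in>carrier M. \<forall>(\<phi>, e)\<in>p. sat M (e(0 := a)) \<phi>))"

definition partial_elementary ::
    "('f, 'r) language \<Rightarrow> ('a, 'f, 'r) fo_struct \<Rightarrow> 'a set \<Rightarrow> ('a \<Rightarrow> 'a) \<Rightarrow> bool" where
  "partial_elementary L M A h \<longleftrightarrow> A \<subseteq> carrier M \<and> h ` A \<subseteq> carrier M \<and>
     (\<forall>\<phi>\<in>formulas L. \<forall>e. e ` fv \<phi> \<subseteq> A \<longrightarrow> (sat M e \<phi> \<longleftrightarrow> sat M (h \<circ> e) \<phi>))"

definition automorphism ::
    "('f, 'r) language \<Rightarrow> ('a, 'f, 'r) fo_struct \<Rightarrow> ('a \<Rightarrow> 'a) \<Rightarrow> bool" where
  "automorphism L M \<sigma> \<longleftrightarrow> bij_betw \<sigma> (carrier M) (carrier M) \<and>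
     (\<forall>f\<in>fsyms L. \<forall>xs. set xs \<subseteq> carrier M \<and> length xs = farity L f \<longrightarrow>
        \<sigma> (fint M f xs) = fint M f (map \<sigma> xs)) \<and>
     (\<forall>r\<in>rsyms L. \<forall>xs. set xs \<subseteq> carrier M \<and> length xs = rarity L r \<longrightarrow>
        (rint M r xs \<longleftrightarrow> rint M r (map \<sigma> xs)))"

definition strongly_homogeneous ::
    "('f, 'r) language \<Rightarrow> 'k rel \<Rightarrow> ('a, 'f, 'r) fo_struct \<Rightarrow> bool" where
  "strongly_homogeneous L \<kappa> M \<longleftrightarrow>
     (\<forall>A h. |A| <o \<kappa> \<and> partial_elementary L M A h \<longrightarrow>
        (\<exists>\<sigma>. automorphism L M \<sigma> \<and> (\<forall>a\<in>A. \<sigma> a = h a)))"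

text \<open>
  There are infinitely many variables, so the number of formulas is the maximum of \<open>\<aleph>\<^sub>0\<close> and the
  number of symbols. "Small" means of cardinality less than \<open>\<kappa>\<close>.
\<close>

definition monster_model ::
    "('f, 'r) language \<Rightarrow> ('f, 'r) fm set \<Rightarrow> 'k rel \<Rightarrow> ('a, 'f, 'r) fo_struct \<Rightarrow> bool" where
  "monster_model L T \<kappa> M \<longleftrightarrow> is_model L T M \<and> Card_order \<kappa> \<and> |formulas L| <o \<kappa> \<and>
     saturated L \<kappa> M \<and> strongly_homogeneous L \<kappa> M"


section \<open>Definable sets and t-minimality\<close>

definition tuples :: "('a, 'f, 'r) fo_struct \<Rightarrow> nat \<Rightarrow> (nat \<Rightarrow> 'a) set" where
  "tuples M n = ({..<n} \<rightarrow>\<^sub>E carrier M)"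

text \<open>Variables below \<open>n\<close> are read from the tuple \<open>x\<close>, the others from the parameters \<open>e\<close>.\<close>

definition with_params :: "nat \<Rightarrow> (nat \<Rightarrow> 'a) \<Rightarrow> (nat \<Rightarrow> 'a) \<Rightarrow> nat \<Rightarrow> 'a" where
  "with_params n x e = (\<lambda>i. if i < n then x i else e i)"

definition definable ::
    "('f, 'r) language \<Rightarrow> ('a, 'f, 'r) fo_struct \<Rightarrow> nat \<Rightarrow> (nat \<Rightarrow> 'a) set \<Rightarrow> bool" where
  "definable L M n D \<longleftrightarrow>
     (\<exists>\<phi>\<in>formulas L. \<exists>e. range e \<subseteq> carrier M \<and> D = {x \<in> tuples M n. sat M (with_params n x e) \<phi>})"

definition definable1 ::
    "('f, 'r) language \<Rightarrow> ('a, 'f, 'r) fo_struct \<Rightarrow> 'a set \<Rightarrow> bool" where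
  "definable1 L M D \<longleftrightarrow> D \<subseteq> carrier M \<and> definable L M 1 {x \<in> tuples M 1. x 0 \<in> D}"

definition topology_basis :: "'a topology \<Rightarrow> 'a set set \<Rightarrow> bool" where
  "topology_basis \<tau> B \<longleftrightarrow> (\<forall>U\<in>B. openin \<tau> U) \<and>
     (\<forall>V x. openin \<tau> V \<and> x \<in> V \<longrightarrow> (\<exists>U\<in>B. x \<in> U \<and> U \<subseteq> V))"

text \<open>
  The family of sets \<open>\<phi>(M, b, e)\<close>, indexed by the \<open>m\<close>-tuples \<open>b\<close> in the definable set \<open>\<psi>(M, e)\<close>. In
  \<open>\<phi>\<close> the variables below \<open>m\<close> stand for the index and the variable \<open>m\<close> for the element.
\<close>

definition family_of ::
    "('a, 'f, 'r) fo_struct \<Rightarrow> nat \<Rightarrow> ('f, 'r) fm \<Rightarrow> ('f, 'r) fm \<Rightarrow> (nat \<Rightarrow> 'a) \<Rightarrow> 'a set set" where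
  "family_of M m \<phi> \<psi> e =
     (\<lambda>b. {a \<in> carrier M. sat M ((with_params m b e)(m := a)) \<phi>}) `
       {b \<in> tuples M m. sat M (with_params m b e) \<psi>}"

text \<open>
  \<open>\<T>\<close> assigns a topology to each model; it witnesses that T is t-minimal. The formulas defining
  the basis do not depend on the model, the parameters \<open>e\<close> may. As in the definition of complete
  theories, only models in the type \<open>'a\<close> are considered. This is again no restriction: a model for
  which no parameters \<open>e\<close> work has an elementary submodel with the same property and at most as many
  elements as there are formulas.
\<close>

definition t_minimal_by ::
    "('f, 'r) language \<Rightarrow> ('f, 'r) fm set \<Rightarrow> (('a, 'f, 'r) fo_struct \<Rightarrow> 'a topology) \<Rightarrow> bool" where
  "t_minimal_by L T \<T> \<longleftrightarrow>
     (\<exists>m. \<exists>\<phi>\<in>formulas L. \<exists>\<psi>\<in>formulas L. \<forall>M. is_model L T M \<longrightarrow>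
        topspace (\<T> M) = carrier M \<and> Hausdorff_space (\<T> M) \<and>
        (\<exists>e. range e \<subseteq> carrier M \<and> topology_basis (\<T> M) (family_of M m \<phi> \<psi> e)) \<and>
        (\<forall>D. definable1 L M D \<longrightarrow> (\<T> M interior_of D \<noteq> {} \<longleftrightarrow> infinite D)))"

definition coord_proj :: "nat \<Rightarrow> (nat \<Rightarrow> nat) \<Rightarrow> (nat \<Rightarrow> 'a) \<Rightarrow> nat \<Rightarrow> 'a" where
  "coord_proj k s x = (\<lambda>i\<in>{..<k}. x (s i))"

text \<open>For nonempty \<open>X\<close> the set below contains 0, as the only nonempty subset of \<open>M\<^sup>0\<close> is open.\<close>

definition dim :: "'a topology \<Rightarrow> nat \<Rightarrow> (nat \<Rightarrow> 'a) set \<Rightarrow> ereal" where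
  "dim \<tau> n X = (if X = {} then - \<infinity> else ereal (real (Max {k. k \<le> n \<and>
     (\<exists>s. strict_mono_on {..<k} s \<and> s ` {..<k} \<subseteq> {..<n} \<and>
        product_topology (\<lambda>_. \<tau>) {..<k} interior_of (coord_proj k s ` X) \<noteq> {})})))"


section \<open>Definable abelian groups and the canonical topology\<close>

text \<open>
  Groups are written multiplicatively, following HOL-Algebra: the operation \<open>+\<close> is \<open>\<otimes>\<^bsub>G\<^esub>\<close>, and
  \<open>0\<close> is \<open>\<one>\<^bsub>G\<^esub>\<close>.
\<close>

definition mult_graph :: "nat \<Rightarrow> (nat \<Rightarrow> 'a) monoid \<Rightarrow> (nat \<Rightarrow> 'a) set" where
  "mult_graph n G = {t \<in> extensional {..<3 * n}. \<exists>x\<in>carrier G. \<exists>y\<in>carrier G.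
     \<forall>i<n. t i = x i \<and> t (n + i) = y i \<and> t (2 * n + i) = (x \<otimes>\<^bsub>G\<^esub> y) i}"

definition definable_abelian_group ::
    "('f, 'r) language \<Rightarrow> ('a, 'f, 'r) fo_struct \<Rightarrow> nat \<Rightarrow> (nat \<Rightarrow> 'a) monoid \<Rightarrow> bool" where
  "definable_abelian_group L M n G \<longleftrightarrow>
     comm_group G \<and> definable L M n (carrier G) \<and> definable L M (3 * n) (mult_graph n G)"

definition big ::
    "('f, 'r) language \<Rightarrow> ('a, 'f, 'r) fo_struct \<Rightarrow> 'a topology \<Rightarrow> nat \<Rightarrow> (nat \<Rightarrow> 'a) monoid \<Rightarrow>
      (nat \<Rightarrow> 'a) set \<Rightarrow> bool" where
  "big L M \<tau> n G X \<longleftrightarrow> definable L M n X \<and> X \<subseteq> carrier G \<and> dim \<tau> n X = dim \<tau> n (carrier G)"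

definition difference_set :: "('g, 'b) monoid_scheme \<Rightarrow> 'g set \<Rightarrow> 'g set" where
  "difference_set G X = {x \<otimes>\<^bsub>G\<^esub> inv\<^bsub>G\<^esub> y | x y. x \<in> X \<and> y \<in> X}"

definition is_group_topology :: "('g, 'b) monoid_scheme \<Rightarrow> 'g topology \<Rightarrow> bool" where
  "is_group_topology G \<sigma> \<longleftrightarrow> topspace \<sigma> = carrier G \<and>
     continuous_map (prod_topology \<sigma> \<sigma>) \<sigma> (\<lambda>(x, y). x \<otimes>\<^bsub>G\<^esub> y) \<and>
     continuous_map \<sigma> \<sigma> (\<lambda>x. inv\<^bsub>G\<^esub> x)"

definition neighborhood_basis_at :: "'g topology \<Rightarrow> 'g \<Rightarrow> 'g set set \<Rightarrow> bool" where
  "neighborhood_basis_at \<sigma> a B \<longleftrightarrow> (\<forall>N\<in>B. a \<in> \<sigma> interior_of N) \<and>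
     (\<forall>U. openin \<sigma> U \<and> a \<in> U \<longrightarrow> (\<exists>N\<in>B. N \<subseteq> U))"

text \<open>These conditions determine \<open>\<sigma>\<close> uniquely, since translations are homeomorphisms.\<close>

definition is_canonical_topology ::
    "('f, 'r) language \<Rightarrow> ('a, 'f, 'r) fo_struct \<Rightarrow> 'a topology \<Rightarrow> nat \<Rightarrow> (nat \<Rightarrow> 'a) monoid \<Rightarrow>
      (nat \<Rightarrow> 'a) topology \<Rightarrow> bool" where
  "is_canonical_topology L M \<tau> n G \<sigma> \<longleftrightarrow> is_group_topology G \<sigma> \<and>
     neighborhood_basis_at \<sigma> \<one>\<^bsub>G\<^esub> {difference_set G X | X. big L M \<tau> n G X}"

end

theory Submission
  imports Defs
begin

text \<open>
  Suppose that the canonical topology is indiscrete, so that \<open>X - X = G\<close> for every big \<open>X\<close>. For big \<open>X\<close>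
  and \<open>g \<in> G\<close> the set \<open>X' = {x \<in> X. x + g \<notin> X}\<close> satisfies \<open>g \<notin> X' - X'\<close>, hence it is not big:
  big sets are almost invariant under translation. If \<open>dim G = 0\<close>, then points are big, which is absurd.
  Otherwise split \<open>G\<close> along one coordinate into disjoint big sets \<open>X\<close> and \<open>Y\<close>. For no \<open>g\<close> is
  \<open>{x \<in> X. x + g \<in> Y}\<close> big, although almost all of \<open>Y\<close> is moved into \<open>Y\<close> by finitely many given
  elements of \<open>X\<close>, so any finite subset of \<open>X\<close> can be translated into \<open>Y\<close>.

  The contradiction comes from a substitute for additivity of dimension, which may fail in t-minimal
  theories: for a definable family of sets \<open>D\<^sub>v \<subseteq> M\<^sup>d\<close> with empty interior, every box contains a finite
  set that is contained in no \<open>D\<^sub>v\<close>. This is proved by induction on \<open>d\<close> together with the fact that a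
  union of two definable sets with empty interior has empty interior; the only consequence of saturation
  needed is that finite sets in a definable family are uniformly bounded.
\<close>

subsection \<open>Predicates definable with parameters\<close>

fun ren_trm :: "(nat \<Rightarrow> nat) \<Rightarrow> 'f trm \<Rightarrow> 'f trm" where
  "ren_trm s (Var i) = Var (s i)"
| "ren_trm s (App f ts) = App f (map (ren_trm s) ts)"

fun ren_fm :: "(nat \<Rightarrow> nat) \<Rightarrow> ('f, 'r) fm \<Rightarrow> ('f, 'r) fm" where
  "ren_fm s (Eq t u) = Eq (ren_trm s t) (ren_trm s u)"
| "ren_fm s (Rel r ts) = Rel r (map (ren_trm s) ts)"
| "ren_fm s (Neg \<phi>) = Neg (ren_fm s \<phi>)"
| "ren_fm s (Conj \<phi> \<psi>) = Conj (ren_fm s \<phi>) (ren_fm s \<psi>)"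
| "ren_fm s (Exists i \<phi>) = Exists (s i) (ren_fm s \<phi>)"

lemma trm_val_ren: "trm_val M e (ren_trm s t) = trm_val M (e \<circ> s) t"
  by (induction t) (auto simp: comp_def cong: map_cong)

text \<open>Bound variables are renamed together with free ones. Injectivity of \<open>s\<close>
  ensures that the update made by a renamed quantifier affects no other variable, so capture cannot
  occur.\<close>

lemma sat_ren:
  assumes "inj s"
  shows "sat M e (ren_fm s \<phi>) \<longleftrightarrow> sat M (e \<circ> s) \<phi>"
proof (induction \<phi> arbitrary: e)
  case (Exists i \<phi>)
  have "(e(s i := a)) \<circ> s = (e \<circ> s)(i := a)" for a
    using assms by (auto simp: fun_eq_iff inj_def)
  then show ?case by (simp only: ren_fm.simps sat.simps Exists.IH)
qed (simp_all add: trm_val_ren comp_def)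

lemma wf_ren_trm: "wf_trm L t \<Longrightarrow> wf_trm L (ren_trm s t)"
  by (induction t) auto

lemma wf_ren_fm: "wf_fm L \<phi> \<Longrightarrow> wf_fm L (ren_fm s \<phi>)"
  by (induction \<phi>) (auto simp: wf_ren_trm)

lemma finite_fv_trm: "finite (fv_trm t)"
  by (induction t) auto

lemma finite_fv: "finite (fv \<phi>)"
  by (induction \<phi>) (auto simp: finite_fv_trm)

lemma trm_val_cong: "(\<And>i. i \<in> fv_trm t \<Longrightarrow> e i = e' i) \<Longrightarrow> trm_val M e t = trm_val M e' t"
proof (induction t)
  case (App f ts)
  then have "map (trm_val M e) ts = map (trm_val M e') ts" by auto
  then show ?case by (simp del: map_eq_conv)
qed simp

lemma sat_cong: "(\<And>i. i \<in> fv \<phi> \<Longrightarrow> e i = e' i) \<Longrightarrow> sat M e \<phi> \<longleftrightarrow> sat M e' \<phi>"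
proof (induction \<phi> arbitrary: e e')
  case (Eq t u)
  then show ?case using trm_val_cong[of t e e' M] trm_val_cong[of u e e' M] by auto
next
  case (Rel r ts)
  then have "map (trm_val M e) ts = map (trm_val M e') ts" by (auto intro!: trm_val_cong)
  then show ?case by (simp del: map_eq_conv)
next
  case (Conj \<phi> \<psi>)
  have "sat M e \<phi> = sat M e' \<phi>" by (rule Conj.IH(1)) (simp add: Conj.prems)
  moreover have "sat M e \<psi> = sat M e' \<psi>" by (rule Conj.IH(2)) (simp add: Conj.prems)
  ultimately show ?case by simp
next
  case (Exists i \<phi>)
  have "sat M (e(i := a)) \<phi> = sat M (e'(i := a)) \<phi>" for a
    by (rule Exists.IH) (simp add: Exists.prems)
  then show ?case by simp
next
  case (Neg \<phi>)
  have "sat M e \<phi> = sat M e' \<phi>" by (rule Neg.IH) (simp add: Neg.prems)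
  then show ?case by simp
qed

text \<open>Replaces the free variables \<open>k\<close> by \<open>j\<close>, by quantification instead of renaming of bound variables.\<close>

fun subst_fm :: "(nat \<times> nat) list \<Rightarrow> ('f, 'r) fm \<Rightarrow> ('f, 'r) fm" where
  "subst_fm [] \<phi> = \<phi>"
| "subst_fm ((k, j) # ps) \<phi> = Exists k (Conj (Eq (Var j) (Var k)) (subst_fm ps \<phi>))"

lemma wf_subst_fm: "wf_fm L \<phi> \<Longrightarrow> wf_fm L (subst_fm ps \<phi>)"
  by (induction ps) auto

text \<open>The quantifiers act from the outside in, so a later pair for the same variable overrides
  an earlier one; hence the reversal in \<open>map_of (rev ps)\<close>. Disjointness ensures that
  every \<open>e j\<close> still has its original value when it is read, and \<open>e j\<close> must
  lie in the carrier because it is the witness of a quantifier.\<close>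

lemma sat_subst_fm:
  assumes "\<And>k j. (k, j) \<in> set ps \<Longrightarrow> e j \<in> carrier M"
    and "fst ` set ps \<inter> snd ` set ps = {}"
  shows "sat M e (subst_fm ps \<phi>) \<longleftrightarrow>
    sat M (\<lambda>i. if i \<in> fst ` set ps then e (the (map_of (rev ps) i)) else e i) \<phi>"
  using assms
proof (induction ps arbitrary: e)
  case (Cons p ps)
  obtain k j where p: "p = (k, j)" by force
  let ?e = "e(k := e j)"
  have kj: "k \<noteq> j" and j: "e j \<in> carrier M" using Cons.prems by (auto simp: p)
  have k: "k \<notin> snd ` set ps" using Cons.prems by (auto simp: p)
  have "sat M e (subst_fm (p # ps) \<phi>) \<longleftrightarrow> sat M ?e (subst_fm ps \<phi>)"
    using kj j by (auto simp: p)
  also have "\<dots> \<longleftrightarrow>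
    sat M (\<lambda>i. if i \<in> fst ` set ps then ?e (the (map_of (rev ps) i)) else ?e i) \<phi>"
  proof (rule Cons.IH)
    fix k' j' assume "(k', j') \<in> set ps"
    then show "?e j' \<in> carrier M" using Cons.prems j by auto
  qed (use Cons.prems in auto)
  also have "(\<lambda>i. if i \<in> fst ` set ps then ?e (the (map_of (rev ps) i)) else ?e i) =
    (\<lambda>i. if i \<in> fst ` set (p # ps) then e (the (map_of (rev (p # ps)) i)) else e i)"
  proof
    fix i
    show "(if i \<in> fst ` set ps then ?e (the (map_of (rev ps) i)) else ?e i) =
      (if i \<in> fst ` set (p # ps) then e (the (map_of (rev (p # ps)) i)) else e i)"
    proof (cases "i \<in> fst ` set ps")
      case True
      then obtain j' where j': "map_of (rev ps) i = Some j'"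
        by (metis map_of_eq_None_iff not_Some_eq set_rev)
      then have "(i, j') \<in> set ps" by (metis map_of_SomeD set_rev)
      then have "j' \<noteq> k" using k by force
      then show ?thesis using True j' by (simp add: p map_add_def)
    next
      case False
      then have "map_of (rev ps) i = None" by (simp add: map_of_eq_None_iff)
      moreover have "map_of (rev ps) k = None" if "i = k" using that calculation by simp
      ultimately show ?thesis using False by (auto simp: p map_add_def)
    qed
  qed
  finally show ?case .
qed simp

lemma ex_subst_fm:
  assumes "wf_fm L \<phi>" "finite S" "S \<inter> f ` S = {}"
  shows "\<exists>\<psi>. wf_fm L \<psi> \<and> (\<forall>e. (\<forall>i\<in>S. e (f i) \<in> carrier M) \<longrightarrow>
    (sat M e \<psi> \<longleftrightarrow> sat M (\<lambda>i. if i \<in> S then e (f i) else e i) \<phi>))"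
proof -
  obtain xs where xs: "set xs = S" "distinct xs" using finite_distinct_list[OF assms(2)] by blast
  let ?ps = "map (\<lambda>i. (i, f i)) xs"
  have ps: "fst ` set ?ps = S" "snd ` set ?ps = f ` S" by (auto simp: xs(1)[symmetric] image_image)
  have mo: "map_of (rev ?ps) i = Some (f i)" if "i \<in> S" for i
    using that xs by (auto simp: rev_map map_of_map_restrict)
  have "sat M e (subst_fm ?ps \<phi>) \<longleftrightarrow> sat M (\<lambda>i. if i \<in> S then e (f i) else e i) \<phi>"
    if "\<forall>i\<in>S. e (f i) \<in> carrier M" for e
  proof -
    have "sat M e (subst_fm ?ps \<phi>) \<longleftrightarrow>
      sat M (\<lambda>i. if i \<in> fst ` set ?ps then e (the (map_of (rev ?ps) i)) else e i) \<phi>"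
      using that xs assms(3) by (intro sat_subst_fm) (auto simp: image_image)
    also have "(\<lambda>i. if i \<in> fst ` set ?ps then e (the (map_of (rev ?ps) i)) else e i) =
      (\<lambda>i. if i \<in> S then e (f i) else e i)"
      unfolding ps(1) using mo by auto
    finally show ?thesis .
  qed
  then show ?thesis using wf_subst_fm[OF assms(1)] by blast
qed

text \<open>The first \<open>d\<close> entries become an extensional function, the format of
  \<open>tuples\<close>, while the remaining ones are shifted by \<open>tsuffix\<close> to form a
  valuation again. Valuations are thus used as stacks: a quantified tuple is put in front of
  everything introduced before it.\<close>

definition tprefix :: "nat \<Rightarrow> (nat \<Rightarrow> 'a) \<Rightarrow> nat \<Rightarrow> 'a" where
  "tprefix d v = restrict v {..<d}"

definition tsuffix :: "nat \<Rightarrow> (nat \<Rightarrow> 'a) \<Rightarrow> nat \<Rightarrow> 'a" where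
  "tsuffix d v = (\<lambda>i. v (d + i))"

definition tjoin :: "nat \<Rightarrow> (nat \<Rightarrow> 'a) \<Rightarrow> (nat \<Rightarrow> 'a) \<Rightarrow> nat \<Rightarrow> 'a" where
  "tjoin d y v = (\<lambda>i. if i < d then y i else v (i - d))"

lemma tprefix_tjoin [simp]: "y \<in> extensional {..<d} \<Longrightarrow> tprefix d (tjoin d y v) = y"
  by (auto simp: tprefix_def tjoin_def fun_eq_iff restrict_def extensional_def)

lemma tsuffix_tjoin [simp]: "tsuffix d (tjoin d y v) = v"
  by (auto simp: tsuffix_def tjoin_def)

lemma tuples_ext: "y \<in> tuples M d \<Longrightarrow> y \<in> extensional {..<d}"
  by (auto simp: tuples_def PiE_def)

section \<open>Closure properties of definable predicates on valuations\<close>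

locale fo_model =
  fixes L :: "('f, 'r) language" and M :: "('a, 'f, 'r) fo_struct"
  assumes carrier_ne: "carrier M \<noteq> {}"
begin

definition env :: "(nat \<Rightarrow> 'a) set" where
  "env = {v. \<forall>i. v i \<in> carrier M}"

text \<open>Function symbols are excluded: an entry either copies one coordinate or is a parameter,
  so a substitution can be undone by identifying variables of a formula.\<close>

definition cterm :: "((nat \<Rightarrow> 'a) \<Rightarrow> 'a) \<Rightarrow> bool" where
  "cterm t \<longleftrightarrow> (\<exists>j. t = (\<lambda>v. v j)) \<or> (\<exists>c\<in>carrier M. t = (\<lambda>_. c))"

text \<open>
  Definability with parameters, for predicates on valuations. A valuation \<open>\<rho> v\<close> of the formula may
  duplicate, permute or omit the entries of \<open>v\<close> and insert parameters, so closure under substitution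
  is immediate.
\<close>

definition dfn :: "((nat \<Rightarrow> 'a) \<Rightarrow> bool) \<Rightarrow> bool" where
  "dfn P \<longleftrightarrow> (\<exists>\<phi>. wf_fm L \<phi> \<and> (\<exists>\<rho>. (\<forall>i. cterm (\<lambda>v. \<rho> v i)) \<and>
     (\<forall>v\<in>env. P v \<longleftrightarrow> sat M (\<rho> v) \<phi>)))"

lemma cterm_var [simp, intro]: "cterm (\<lambda>v. v j)"
  by (auto simp: cterm_def)

lemma cterm_const [intro]: "c \<in> carrier M \<Longrightarrow> cterm (\<lambda>_. c)"
  by (auto simp: cterm_def)

lemma cterm_if: "\<lbrakk>b \<Longrightarrow> cterm s; \<not> b \<Longrightarrow> cterm t\<rbrakk> \<Longrightarrow> cterm (\<lambda>v. if b then s v else t v)"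
  by (cases b) auto

lemma cterm_comp: "cterm t \<Longrightarrow> (\<And>i. cterm (\<lambda>v. \<rho> v i)) \<Longrightarrow> cterm (\<lambda>v. t (\<rho> v))"
  unfolding cterm_def by fastforce

lemma env_subst: "(\<And>i. cterm (\<lambda>v. \<rho> v i)) \<Longrightarrow> v \<in> env \<Longrightarrow> \<rho> v \<in> env"
  unfolding env_def cterm_def by simp (metis)

lemma dfn_cong: "dfn P \<Longrightarrow> (\<And>v. v \<in> env \<Longrightarrow> Q v \<longleftrightarrow> P v) \<Longrightarrow> dfn Q"
  unfolding dfn_def by simp

lemma dfn_subst:
  assumes "dfn P" "\<And>i. cterm (\<lambda>v. \<rho> v i)" "\<And>v. v \<in> env \<Longrightarrow> Q v \<longleftrightarrow> P (\<rho> v)"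
  shows "dfn Q"
proof -
  obtain \<phi> \<rho>' where *: "wf_fm L \<phi>" "\<And>i. cterm (\<lambda>v. \<rho>' v i)"
    "\<And>v. v \<in> env \<Longrightarrow> P v \<longleftrightarrow> sat M (\<rho>' v) \<phi>"
    using assms(1) unfolding dfn_def by blast
  have "cterm (\<lambda>v. \<rho>' (\<rho> v) i)" for i
    using cterm_comp[OF *(2) assms(2)] .
  moreover have "Q v \<longleftrightarrow> sat M (\<rho>' (\<rho> v)) \<phi>" if "v \<in> env" for v
    using that assms(3) *(3) env_subst[of \<rho>, OF assms(2)] by simp
  ultimately show ?thesis
    unfolding dfn_def using *(1) by (intro exI[of _ \<phi>] conjI exI[of _ "\<lambda>v. \<rho>' (\<rho> v)"]) auto
qed

lemma dfn_not: "dfn P \<Longrightarrow> dfn (\<lambda>v. \<not> P v)"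
  unfolding dfn_def by (metis sat.simps(3) wf_fm.simps(3))

lemma dfn_conj:
  assumes "dfn P" "dfn Q"
  shows "dfn (\<lambda>v. P v \<and> Q v)"
proof -
  obtain \<phi> \<rho> where 1: "wf_fm L \<phi>" "\<And>i. cterm (\<lambda>v. \<rho> v i)"
    "\<And>v. v \<in> env \<Longrightarrow> P v \<longleftrightarrow> sat M (\<rho> v) \<phi>"
    using assms(1) unfolding dfn_def by blast
  obtain \<psi> \<eta> where 2: "wf_fm L \<psi>" "\<And>i. cterm (\<lambda>v. \<eta> v i)"
    "\<And>v. v \<in> env \<Longrightarrow> Q v \<longleftrightarrow> sat M (\<eta> v) \<psi>"
    using assms(2) unfolding dfn_def by blast
  \<comment> \<open>The two formulas come with unrelated valuations, so their variables are first
    moved apart to even and odd numbers.\<close>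
  let ?\<chi> = "Conj (ren_fm (\<lambda>i. 2 * i) \<phi>) (ren_fm (\<lambda>i. Suc (2 * i)) \<psi>)"
  let ?\<rho> = "\<lambda>v i. if even i then \<rho> v (i div 2) else \<eta> v (i div 2)"
  have inj: "inj (\<lambda>i::nat. 2 * i)" "inj (\<lambda>i::nat. Suc (2 * i))" by (auto simp: inj_def)
  have "sat M (?\<rho> v) ?\<chi> \<longleftrightarrow> sat M (\<rho> v) \<phi> \<and> sat M (\<eta> v) \<psi>" for v
    by (simp add: sat_ren[OF inj(1)] sat_ren[OF inj(2)] comp_def)
  moreover have "cterm (\<lambda>v. ?\<rho> v i)" for i
    using 1(2) 2(2) by (cases "even i") auto
  ultimately show ?thesis
    unfolding dfn_def using 1 2
    by (intro exI[of _ ?\<chi>] conjI exI[of _ ?\<rho>]) (auto intro: wf_ren_fm)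
qed

lemma dfn_eq: "cterm s \<Longrightarrow> cterm t \<Longrightarrow> dfn (\<lambda>v. s v = t v)"
  unfolding dfn_def
  by (intro exI[of _ "Eq (Var 0) (Var 1)"] conjI exI[of _ "\<lambda>v i. if i = 0 then s v else t v"])
    (auto intro: cterm_if)

lemma dfn_True [simp]: "dfn (\<lambda>_. True)"
  using dfn_eq[of "\<lambda>v. v 0" "\<lambda>v. v 0"] by simp

lemma dfn_const [simp]: "dfn (\<lambda>_. b)"
  using dfn_True dfn_not[OF dfn_True] by (cases b) auto

lemma dfn_disj: "dfn P \<Longrightarrow> dfn Q \<Longrightarrow> dfn (\<lambda>v. P v \<or> Q v)"
  using dfn_not[OF dfn_conj[OF dfn_not dfn_not]] by simp

lemma dfn_imp: "dfn P \<Longrightarrow> dfn Q \<Longrightarrow> dfn (\<lambda>v. P v \<longrightarrow> Q v)"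
  unfolding imp_conv_disj by (rule dfn_disj[OF dfn_not])

lemma dfn_ball: "finite I \<Longrightarrow> (\<And>i. i \<in> I \<Longrightarrow> dfn (P i)) \<Longrightarrow> dfn (\<lambda>v. \<forall>i\<in>I. P i v)"
proof (induction I rule: finite_induct)
  case (insert i I)
  have "dfn (\<lambda>v. P i v \<and> (\<forall>i\<in>I. P i v))"
    by (rule dfn_conj) (use insert in simp_all)
  then show ?case by simp
qed simp

text \<open>Several variables of the formula may read the quantified entry. Renaming by
  \<open>Suc\<close> makes variable 0 fresh, all those variables are identified with it, and a
  single quantifier over it is added.\<close>

lemma dfn_ex1:
  assumes "dfn (\<lambda>w. P (w 0) (tsuffix 1 w))"
  shows "dfn (\<lambda>v. \<exists>a\<in>carrier M. P a v)"
proof -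
  obtain \<phi> \<rho> where 1: "wf_fm L \<phi>" "\<And>i. cterm (\<lambda>v. \<rho> v i)"
    "\<And>v. v \<in> env \<Longrightarrow> P (v 0) (tsuffix 1 v) \<longleftrightarrow> sat M (\<rho> v) \<phi>"
    using assms unfolding dfn_def by blast
  define K where "K = {k. (\<lambda>v. \<rho> v k) = (\<lambda>v. v 0)}"
  let ?S = "Suc ` (K \<inter> fv \<phi>)"
  obtain c where c: "c \<in> carrier M" using carrier_ne by blast
  obtain \<psi> where \<psi>: "wf_fm L \<psi>" "\<And>e. e 0 \<in> carrier M \<Longrightarrow>
    sat M e \<psi> \<longleftrightarrow> sat M (\<lambda>i. if i \<in> ?S then e 0 else e i) (ren_fm Suc \<phi>)"
    using ex_subst_fm[of L "ren_fm Suc \<phi>" ?S "\<lambda>_. 0" M] 1(1) finite_fv[of \<phi>]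
    by (force simp: wf_ren_fm)
  \<comment> \<open>The value \<open>c\<close> is a dummy: at 0 the quantifier overwrites it, at the
    variables from \<open>K\<close> that occur in the formula the substitution does. The other
    variables do not read entry 0, so the \<open>c\<close> put there by \<open>tjoin\<close> does
    not reach them.\<close>
  let ?\<rho> = "\<lambda>v i. if i = 0 \<or> i - 1 \<in> K then c else \<rho> (tjoin 1 (\<lambda>_. c) v) (i - 1)"
  have "cterm (\<lambda>v. ?\<rho> v i)" for i
  proof (cases "i = 0 \<or> i - 1 \<in> K")
    case False
    have "cterm (\<lambda>v. tjoin 1 (\<lambda>_. c) v i)" for i
      using c by (cases i) (auto simp: tjoin_def)
    from cterm_comp[OF 1(2)[of "i - 1"], of "tjoin 1 (\<lambda>_. c)", OF this] show ?thesis
      using False by simp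
  qed (use c in auto)
  moreover have "(\<exists>a\<in>carrier M. P a v) \<longleftrightarrow> sat M (?\<rho> v) (Exists 0 \<psi>)" if v: "v \<in> env" for v
  proof -
    have "P a v \<longleftrightarrow> sat M ((?\<rho> v)(0 := a)) \<psi>" if a: "a \<in> carrier M" for a
    proof -
      let ?w = "tjoin 1 (\<lambda>_. a) v"
      have w: "?w \<in> env" using a v by (auto simp: env_def tjoin_def)
      have "P a v \<longleftrightarrow> P (?w 0) (tsuffix 1 ?w)" unfolding tsuffix_tjoin by (simp add: tjoin_def)
      also have "\<dots> \<longleftrightarrow> sat M (\<rho> ?w) \<phi>" using 1(3) w by blast
      also have "\<dots> \<longleftrightarrow> sat M ((\<lambda>i. if i \<in> ?S then a else ((?\<rho> v)(0 := a)) i) \<circ> Suc) \<phi>"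
      proof (rule sat_cong)
        fix i assume i: "i \<in> fv \<phi>"
        show "\<rho> ?w i = ((\<lambda>i. if i \<in> ?S then a else ((?\<rho> v)(0 := a)) i) \<circ> Suc) i"
        proof (cases "i \<in> K")
          case True
          then have "\<rho> ?w i = ?w 0" unfolding K_def by (metis (mono_tags) mem_Collect_eq)
          then show ?thesis using True i by (simp add: tjoin_def)
        next
          case False
          have "\<rho> ?w i = \<rho> (tjoin 1 (\<lambda>_. c) v) i"
          proof -
            from 1(2)[of i] show ?thesis
            proof (unfold cterm_def, elim disjE exE bexE)
              fix j assume j: "(\<lambda>v. \<rho> v i) = (\<lambda>v. v j)"
              then have "j \<noteq> 0" using False by (auto simp: K_def)
              moreover have "\<rho> u i = u j" for u using j by (metis)
              ultimately show ?thesis by (simp add: tjoin_def)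
            next
              fix j assume "(\<lambda>v. \<rho> v i) = (\<lambda>_. j)"
              then show ?thesis by metis
            qed
          qed
          then show ?thesis using False by (simp add: image_iff)
        qed
      qed
      also have "\<dots> \<longleftrightarrow> sat M (\<lambda>i. if i \<in> ?S then a else ((?\<rho> v)(0 := a)) i) (ren_fm Suc \<phi>)"
        by (simp add: sat_ren)
      also have "\<dots> \<longleftrightarrow> sat M ((?\<rho> v)(0 := a)) \<psi>"
        using \<psi>(2)[of "(?\<rho> v)(0 := a)"] a by (simp only: fun_upd_same)
      finally show ?thesis .
    qed
    then show ?thesis by simp
  qed
  ultimately show ?thesis
    unfolding dfn_def using \<psi>(1)
    by (intro exI[of _ "Exists 0 \<psi>"] conjI exI[of _ ?\<rho>]) auto
qed

lemma tuples_Suc: "b \<in> tuples M (Suc m) \<longleftrightarrow> (\<exists>y\<in>tuples M m. \<exists>s\<in>carrier M. b = y(m := s))"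
  unfolding tuples_def lessThan_Suc PiE_insert_eq by auto

lemma dfn_ex:
  assumes "dfn (\<lambda>w. P (tprefix m w) (tsuffix m w))"
  shows "dfn (\<lambda>v. \<exists>b\<in>tuples M m. P b v)"
  using assms
proof (induction m arbitrary: P)
  case 0
  have "tsuffix 0 v = v" for v :: "nat \<Rightarrow> 'a" by (simp add: tsuffix_def)
  then have "dfn (P (\<lambda>_. undefined))" using 0 by (simp add: tprefix_def restrict_def)
  then show ?case by (simp add: tuples_def)
next
  case (Suc m)
  have "(\<exists>b\<in>tuples M (Suc m). P b v) \<longleftrightarrow> (\<exists>y\<in>tuples M m. \<exists>s\<in>carrier M. P (y(m := s)) v)" for v
    unfolding tuples_Suc Bex_def by blast
  moreover have "dfn (\<lambda>v. \<exists>y\<in>tuples M m. \<exists>s\<in>carrier M. P (y(m := s)) v)"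
  proof (rule Suc.IH, rule dfn_ex1)
    show "dfn (\<lambda>w. P ((tprefix m (tsuffix 1 w))(m := w 0)) (tsuffix m (tsuffix 1 w)))"
    proof (rule dfn_subst[OF Suc.prems, where \<rho> = "\<lambda>w i. if i < m then w (Suc i) else if i = m then w 0 else w i"])
      fix v :: "nat \<Rightarrow> 'a"
      have "(tprefix m (tsuffix 1 v))(m := v 0) = tprefix (Suc m) (\<lambda>i. if i < m then v (Suc i) else if i = m then v 0 else v i)"
        by (auto simp: tprefix_def tsuffix_def fun_eq_iff)
      moreover have "tsuffix m (tsuffix 1 v) = tsuffix (Suc m) (\<lambda>i. if i < m then v (Suc i) else if i = m then v 0 else v i)"
        by (auto simp: tsuffix_def)
      ultimately show "P ((tprefix m (tsuffix 1 v))(m := v 0)) (tsuffix m (tsuffix 1 v)) \<longleftrightarrow>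
        P (tprefix (Suc m) (\<lambda>i. if i < m then v (Suc i) else if i = m then v 0 else v i))
          (tsuffix (Suc m) (\<lambda>i. if i < m then v (Suc i) else if i = m then v 0 else v i))"
        by simp
    qed (auto intro!: cterm_if)
  qed
  ultimately show ?case by simp
qed

lemma dfn_all:
  assumes "dfn (\<lambda>w. P (tprefix m w) (tsuffix m w))"
  shows "dfn (\<lambda>v. \<forall>b\<in>tuples M m. P b v)"
proof -
  have "dfn (\<lambda>v. \<exists>b\<in>tuples M m. \<not> P b v)" by (intro dfn_ex dfn_not assms)
  from dfn_not[OF this] show ?thesis by simp
qed

section \<open>Passage between \<open>definable\<close> and \<open>dfn\<close>\<close>

lemma dfn_if_definable:
  assumes "definable L M n X"
  shows "dfn (\<lambda>v. tprefix n v \<in> X)"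
proof -
  obtain \<phi> e where *: "wf_fm L \<phi>" "range e \<subseteq> carrier M"
    "X = {x \<in> tuples M n. sat M (with_params n x e) \<phi>}"
    using assms unfolding definable_def formulas_def by blast
  have "tprefix n v \<in> X \<longleftrightarrow> sat M (with_params n v e) \<phi>" if "v \<in> env" for v
  proof -
    have "tprefix n v \<in> tuples M n" using that by (auto simp: tprefix_def tuples_def env_def)
    moreover have "with_params n (tprefix n v) e = with_params n v e"
      by (auto simp: tprefix_def with_params_def)
    ultimately show ?thesis by (simp add: *(3))
  qed
  moreover have "cterm (\<lambda>v. with_params n v e i)" for i
    using *(2) by (cases "i < n") (auto simp: with_params_def)
  ultimately show ?thesis
    unfolding dfn_def using *(1) by (intro exI[of _ \<phi>] conjI exI[of _ "\<lambda>v. with_params n v e"]) auto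
qed

text \<open>The formula has to be brought into the form where variables below \<open>n\<close> are
  the tuple and the others are parameters. Its variables are shifted by \<open>n\<close>; those that
  read a tuple entry are then identified with that entry, and the others become parameters. Entries
  from \<open>n\<close> on do not influence membership and are filled with \<open>c\<close>.\<close>

lemma definable_if_dfn:
  assumes "dfn (\<lambda>v. tprefix n v \<in> X)" "X \<subseteq> tuples M n"
  shows "definable L M n X"
proof -
  obtain \<phi> \<rho> where 1: "wf_fm L \<phi>" "\<And>i. cterm (\<lambda>v. \<rho> v i)"
    "\<And>v. v \<in> env \<Longrightarrow> tprefix n v \<in> X \<longleftrightarrow> sat M (\<rho> v) \<phi>"
    using assms(1) unfolding dfn_def by blast
  obtain c where c: "c \<in> carrier M" using carrier_ne by blast
  let ?w = "\<lambda>x i. if i < n then x i else c"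
  define K where "K = {k \<in> fv \<phi>. \<exists>j<n. (\<lambda>v. \<rho> v k) = (\<lambda>v. v j)}"
  \<comment> \<open>For a shifted variable \<open>i\<close>, this is a tuple entry that the original
    variable \<open>i - n\<close> reads.\<close>
  define f where "f = (\<lambda>i. SOME j. j < n \<and> (\<lambda>v. \<rho> v (i - n)) = (\<lambda>v. v j))"
  have f: "f (n + k) < n \<and> (\<lambda>v. \<rho> v k) = (\<lambda>v. v (f (n + k)))" if "k \<in> K" for k
  proof -
    have "\<exists>j. j < n \<and> (\<lambda>v. \<rho> v k) = (\<lambda>v. v j)" using that unfolding K_def by blast
    from someI_ex[OF this] show ?thesis unfolding f_def diff_add_inverse .
  qed
  have f1: "f (n + k) < n" if "k \<in> K" for k using f[OF that] by (rule conjunct1)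
  have f2: "\<rho> v k = v (f (n + k))" if "k \<in> K" for v k
    using fun_cong[OF conjunct2[OF f[OF that]]] .
  let ?S = "(+) n ` K"
  have fin: "finite ?S" using finite_fv[of \<phi>] by (auto simp: K_def)
  have dis: "?S \<inter> f ` ?S = {}" using f1 by fastforce
  obtain \<psi> where \<psi>: "wf_fm L \<psi>" "\<And>e. \<forall>i\<in>?S. e (f i) \<in> carrier M \<Longrightarrow>
    sat M e \<psi> \<longleftrightarrow> sat M (\<lambda>i. if i \<in> ?S then e (f i) else e i) (ren_fm ((+) n) \<phi>)"
    using ex_subst_fm[OF wf_ren_fm[OF 1(1)] fin dis, of M "(+) n"] by blast
  define e where "e = (\<lambda>i. \<rho> (\<lambda>_. c) (i - n))"
  have e: "range e \<subseteq> carrier M"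
    using env_subst[of \<rho>, OF 1(2)] c by (auto simp: e_def env_def)
  have "x \<in> X \<longleftrightarrow> sat M (with_params n x e) \<psi>" if x: "x \<in> tuples M n" for x
  proof -
    have w: "?w x \<in> env" using x c by (auto simp: env_def tuples_def PiE_def)
    have "tprefix n (?w x) = x" using x by (auto simp: tprefix_def tuples_def fun_eq_iff PiE_def extensional_def)
    then have "x \<in> X \<longleftrightarrow> sat M (\<rho> (?w x)) \<phi>" using 1(3)[OF w] by simp
    also have "\<dots> \<longleftrightarrow> sat M ((\<lambda>i. if i \<in> ?S then with_params n x e (f i) else with_params n x e i) \<circ> (+) n) \<phi>"
    proof (rule sat_cong)
      fix k assume k: "k \<in> fv \<phi>"
      show "\<rho> (?w x) k = ((\<lambda>i. if i \<in> ?S then with_params n x e (f i) else with_params n x e i) \<circ> (+) n) k"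
      proof (cases "k \<in> K")
        case True
        have "\<rho> (?w x) k = ?w x (f (n + k))" using f2[OF True] .
        then show ?thesis using True f1[OF True] by (simp add: with_params_def)
      next
        case False
        have "\<rho> (?w x) k = \<rho> (\<lambda>_. c) k"
          using 1(2)[of k]
        proof (unfold cterm_def, elim disjE exE bexE)
          fix j assume j: "(\<lambda>v. \<rho> v k) = (\<lambda>v. v j)"
          then have "\<not> j < n" using False k by (auto simp: K_def)
          moreover have "\<rho> u k = u j" for u using j by metis
          ultimately show ?thesis by simp
        next
          fix j assume "(\<lambda>v. \<rho> v k) = (\<lambda>_. j)"
          then show ?thesis by metis
        qed
        then show ?thesis using False by (auto simp: with_params_def e_def)
      qed
    qed
    also have "\<dots> \<longleftrightarrow> sat M (\<lambda>i. if i \<in> ?S then with_params n x e (f i) else with_params n x e i) (ren_fm ((+) n) \<phi>)"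
      by (simp add: sat_ren)
    also have "\<dots> \<longleftrightarrow> sat M (with_params n x e) \<psi>"
      using \<psi>(2)[of "with_params n x e"] f1 x by (auto simp: with_params_def tuples_def PiE_def)
    finally show ?thesis .
  qed
  then have "X = {x \<in> tuples M n. sat M (with_params n x e) \<psi>}" using assms(2) by auto
  then show ?thesis unfolding definable_def formulas_def using \<psi>(1) e by blast
qed

text \<open>A formula has finitely many free variables and each of them reads at most one entry. The
  bound \<open>p\<close> makes induction on the number of relevant parameters possible.\<close>

lemma dfn_support:
  assumes "dfn P"
  shows "\<exists>p. \<forall>v\<in>env. \<forall>v'\<in>env. (\<forall>i<p. v i = v' i) \<longrightarrow> P v = P v'"
proof -
  obtain \<phi> \<rho> where 1: "wf_fm L \<phi>" "\<And>i. cterm (\<lambda>v. \<rho> v i)"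
    "\<And>v. v \<in> env \<Longrightarrow> P v \<longleftrightarrow> sat M (\<rho> v) \<phi>"
    using assms unfolding dfn_def by blast
  have "\<exists>p. \<forall>v v'. (\<forall>i<p. v i = v' i) \<longrightarrow> \<rho> v k = \<rho> v' k" for k
    using 1(2)[of k]
  proof (unfold cterm_def, elim disjE exE bexE)
    fix j assume "(\<lambda>v. \<rho> v k) = (\<lambda>v. v j)"
    then have "\<rho> u k = u j" for u by metis
    then show ?thesis by (intro exI[of _ "Suc j"]) auto
  next
    fix j assume "(\<lambda>v. \<rho> v k) = (\<lambda>_. j)"
    then have "\<rho> u k = j" for u by metis
    then show ?thesis by auto
  qed
  then obtain p where p: "\<And>k v v'. (\<forall>i<p k. v i = v' i) \<Longrightarrow> \<rho> v k = \<rho> v' k" by metis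
  have "P v = P v'" if v: "v \<in> env" "v' \<in> env" "\<forall>i<Max (insert 0 (p ` fv \<phi>)). v i = v' i" for v v'
  proof -
    have "\<rho> v k = \<rho> v' k" if "k \<in> fv \<phi>" for k
    proof (rule p, intro allI impI)
      fix i assume "i < p k"
      also have "p k \<le> Max (insert 0 (p ` fv \<phi>))" using that finite_fv[of \<phi>] by (intro Max_ge) auto
      finally show "v i = v' i" using v by blast
    qed
    then have "sat M (\<rho> v) \<phi> = sat M (\<rho> v') \<phi>" by (rule sat_cong)
    then show ?thesis using 1(3) v by simp
  qed
  then show ?thesis by blast
qed

end

text \<open>Serves to show that countable parameter sets are small: a monster model is saturated
  over sets with at most as many elements as there are formulas.\<close>

lemma infinite_formulas: "infinite (formulas L)"
proof -
  have "inj (\<lambda>i. Eq (Var 0) (Var i))" by (auto simp: inj_def)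
  then have "infinite (range (\<lambda>i. Eq (Var 0) (Var i)))" by (metis finite_imageD infinite_UNIV_nat)
  moreover have "range (\<lambda>i. Eq (Var 0) (Var i)) \<subseteq> formulas L" by (auto simp: formulas_def)
  ultimately show ?thesis using finite_subset by blast
qed

subsection \<open>Saturated models with a tame topology\<close>

definition tslice :: "nat \<Rightarrow> (nat \<Rightarrow> 'a) set \<Rightarrow> 'a \<Rightarrow> (nat \<Rightarrow> 'a) set" where
  "tslice d D s = {y \<in> extensional {..<d}. y(d := s) \<in> D}"

text \<open>A single tuple of length \<open>d * m\<close> codes \<open>d\<close> indices of basic
  open sets; block \<open>i\<close> is the index for coordinate \<open>i\<close>.\<close>

definition tblock :: "nat \<Rightarrow> nat \<Rightarrow> (nat \<Rightarrow> 'a) \<Rightarrow> nat \<Rightarrow> 'a" where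
  "tblock m i b = (\<lambda>j\<in>{..<m}. b (i * m + j))"

text \<open>Non-empty interior in the product topology, expressed by an open box. For
  \<open>d = 0\<close> it means that \<open>D\<close> contains the empty tuple.\<close>

definition tsolid :: "'a topology \<Rightarrow> nat \<Rightarrow> (nat \<Rightarrow> 'a) set \<Rightarrow> bool" where
  "tsolid \<tau> d D \<longleftrightarrow> (\<exists>U. (\<forall>i<d. openin \<tau> (U i) \<and> U i \<noteq> {}) \<and> (\<Pi>\<^sub>E i\<in>{..<d}. U i) \<subseteq> D)"

lemma tsolid_iff:
  "tsolid \<tau> d D \<longleftrightarrow> product_topology (\<lambda>_. \<tau>) {..<d} interior_of D \<noteq> {}"
proof
  assume "tsolid \<tau> d D"
  then obtain U where U: "\<forall>i<d. openin \<tau> (U i) \<and> U i \<noteq> {}" "(\<Pi>\<^sub>E i\<in>{..<d}. U i) \<subseteq> D"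
    unfolding tsolid_def by blast
  have "openin (product_topology (\<lambda>_. \<tau>) {..<d}) (\<Pi>\<^sub>E i\<in>{..<d}. U i)"
    using U by (subst openin_PiE) (auto intro: disjI2)
  then have "(\<Pi>\<^sub>E i\<in>{..<d}. U i) \<subseteq> product_topology (\<lambda>_. \<tau>) {..<d} interior_of D"
    using U(2) by (rule interior_of_maximal[rotated])
  moreover have "(\<Pi>\<^sub>E i\<in>{..<d}. U i) \<noteq> {}" using U(1) by (simp add: PiE_eq_empty_iff)
  ultimately show "product_topology (\<lambda>_. \<tau>) {..<d} interior_of D \<noteq> {}" by blast
next
  let ?I = "product_topology (\<lambda>_. \<tau>) {..<d} interior_of D"
  assume "?I \<noteq> {}"
  then obtain x where x: "x \<in> ?I" by blast
  have "openin (product_topology (\<lambda>_. \<tau>) {..<d}) ?I" by simp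
  then obtain U where U: "\<forall>i<d. openin \<tau> (U i)" "x \<in> (\<Pi>\<^sub>E i\<in>{..<d}. U i)"
    "(\<Pi>\<^sub>E i\<in>{..<d}. U i) \<subseteq> ?I"
    using x unfolding openin_product_topology_alt by (metis lessThan_iff)
  have "U i \<noteq> {}" if "i < d" for i using U(2) that by auto
  moreover have "(\<Pi>\<^sub>E i\<in>{..<d}. U i) \<subseteq> D" using U(3) interior_of_subset by (rule subset_trans)
  ultimately show "tsolid \<tau> d D"
    unfolding tsolid_def using U(1) by (intro exI[of _ U]) simp
qed

lemma tsolid_mono: "tsolid \<tau> d D \<Longrightarrow> D \<subseteq> D' \<Longrightarrow> tsolid \<tau> d D'"
  unfolding tsolid_def by blast

text \<open>Collects what the argument takes from a monster model of a t-minimal theory. Saturation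
  appears only for countably many definable conditions on one element, and every
  \<open>m\<close>-tuple is an index of a basic set, where \<open>B b\<close> may be empty.\<close>

locale tame_model = fo_model L M for L :: "('f, 'r) language" and M :: "('a, 'f, 'r) fo_struct" +
  fixes \<tau> :: "'a topology" and m :: nat and B :: "(nat \<Rightarrow> 'a) \<Rightarrow> 'a set"
  assumes saturation: "\<And>Q :: nat \<Rightarrow> 'a \<Rightarrow> bool. \<lbrakk>\<And>k. dfn (\<lambda>v. Q k (v 0));
      \<And>K. \<exists>a\<in>carrier M. \<forall>k\<le>K. Q k a\<rbrakk> \<Longrightarrow> \<exists>a\<in>carrier M. \<forall>k. Q k a"
    and topspace: "topspace \<tau> = carrier M"
    and hausdorff: "Hausdorff_space \<tau>"
    and openin_B: "\<And>b. b \<in> tuples M m \<Longrightarrow> openin \<tau> (B b)"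
    and basis_B: "\<And>V x. openin \<tau> V \<Longrightarrow> x \<in> V \<Longrightarrow> \<exists>b\<in>tuples M m. x \<in> B b \<and> B b \<subseteq> V"
    and dfn_B: "dfn (\<lambda>v. v m \<in> B (tprefix m v))"
    and interior_iff: "\<And>D. D \<subseteq> carrier M \<Longrightarrow> dfn (\<lambda>v. v 0 \<in> D) \<Longrightarrow>
      \<tau> interior_of D \<noteq> {} \<longleftrightarrow> infinite D"
begin

lemma env_tjoin: "y \<in> tuples M d \<Longrightarrow> v \<in> env \<Longrightarrow> tjoin d y v \<in> env"
  by (auto simp: env_def tjoin_def tuples_def PiE_def)

lemma env_tsuffix: "v \<in> env \<Longrightarrow> tsuffix d v \<in> env"
  by (auto simp: env_def tsuffix_def)

lemma tprefix_tuples: "v \<in> env \<Longrightarrow> tprefix d v \<in> tuples M d"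
  by (auto simp: env_def tprefix_def tuples_def)

definition dfam :: "nat \<Rightarrow> ((nat \<Rightarrow> 'a) \<Rightarrow> (nat \<Rightarrow> 'a) set) \<Rightarrow> bool" where
  "dfam d D \<longleftrightarrow> dfn (\<lambda>w. tprefix d w \<in> D (tsuffix d w))"

lemma dfn_mem:
  assumes "dfam d D" "\<And>i. cterm (\<lambda>w. \<rho> w i)" "\<And>i. i < d \<Longrightarrow> cterm (\<lambda>w. t w i)"
  shows "dfn (\<lambda>w. tprefix d (t w) \<in> D (\<rho> w))"
proof (rule dfn_subst[OF assms(1)[unfolded dfam_def], of "\<lambda>w. tjoin d (t w) (\<rho> w)"])
  show "cterm (\<lambda>v. tjoin d (t v) (\<rho> v) i)" for i
    using assms(2,3) by (cases "i < d") (auto simp: tjoin_def)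
  have "tprefix d (tjoin d y v) = tprefix d y" for y v :: "nat \<Rightarrow> 'a"
    by (auto simp: tprefix_def tjoin_def fun_eq_iff)
  then show "tprefix d (t v) \<in> D (\<rho> v) \<longleftrightarrow>
    tprefix d (tjoin d (t v) (\<rho> v)) \<in> D (tsuffix d (tjoin d (t v) (\<rho> v)))" for v
    by simp
qed

lemma dfn_mem_B:
  assumes "\<And>j. j < m \<Longrightarrow> cterm (\<lambda>w. t w j)" "cterm s"
  shows "dfn (\<lambda>w. s w \<in> B (tprefix m (t w)))"
proof (rule dfn_subst[OF dfn_B, of "\<lambda>w i. if i < m then t w i else s w"])
  show "cterm (\<lambda>v. if i < m then t v i else s v)" for i
    using assms by (auto intro: cterm_if)
  have "tprefix m (\<lambda>i. if i < m then t v i else s v) = tprefix m (t v)" for v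
    by (auto simp: tprefix_def fun_eq_iff)
  then show "s v \<in> B (tprefix m (t v)) \<longleftrightarrow>
    (if m < m then t v m else s v) \<in> B (tprefix m (\<lambda>i. if i < m then t v i else s v))" for v
    by simp
qed

lemma tsolid_point: "tsolid \<tau> d D \<Longrightarrow> \<exists>y\<in>tuples M d. y \<in> D"
proof -
  assume "tsolid \<tau> d D"
  then obtain U where U: "\<forall>i<d. openin \<tau> (U i) \<and> U i \<noteq> {}" "(\<Pi>\<^sub>E i\<in>{..<d}. U i) \<subseteq> D"
    unfolding tsolid_def by blast
  then have "(\<Pi>\<^sub>E i\<in>{..<d}. U i) \<noteq> {}" by (simp add: PiE_eq_empty_iff)
  moreover have "(\<Pi>\<^sub>E i\<in>{..<d}. U i) \<subseteq> tuples M d"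
    unfolding tuples_def using U(1) openin_subset[of \<tau>] topspace by (intro PiE_mono) blast
  ultimately show ?thesis using U(2) by blast
qed

subsection \<open>Uniform finiteness\<close>

text \<open>Having \<open>N + 1\<close> distinct elements is a first-order condition. The infinite
  case is listed separately since \<open>card\<close> is 0 there.\<close>

lemma card_gt_iff:
  "(\<exists>c\<in>tuples M (Suc N). inj_on c {..<Suc N} \<and> (\<forall>i<Suc N. c i \<in> A)) \<longleftrightarrow>
    infinite A \<or> N < card A" if "A \<subseteq> carrier M"
proof
  assume "\<exists>c\<in>tuples M (Suc N). inj_on c {..<Suc N} \<and> (\<forall>i<Suc N. c i \<in> A)"
  then obtain c where c: "inj_on c {..<Suc N}" "c ` {..<Suc N} \<subseteq> A" by auto
  show "infinite A \<or> N < card A"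
    using card_inj_on_le[OF c] by auto
next
  assume "infinite A \<or> N < card A"
  then obtain F where F: "F \<subseteq> A" "card F = Suc N" "finite F"
    by (metis Suc_leI infinite_arbitrarily_large obtain_subset_with_card_n)
  then obtain c where c: "bij_betw c {..<Suc N} F"
    by (metis atLeast0LessThan ex_bij_betw_nat_finite)
  let ?c = "restrict c {..<Suc N}"
  have "inj_on ?c {..<Suc N}" using c by (auto simp: bij_betw_def inj_on_def)
  moreover have "\<forall>i<Suc N. ?c i \<in> A" using c F(1) by (auto simp: bij_betw_def)
  moreover then have "?c \<in> tuples M (Suc N)" using that by (auto simp: tuples_def)
  ultimately show "\<exists>c\<in>tuples M (Suc N). inj_on c {..<Suc N} \<and> (\<forall>i<Suc N. c i \<in> A)"
    by blast
qed

text \<open>Induction on the number \<open>p\<close> of parameters. If the cardinalities are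
  unbounded, then for each \<open>N\<close> some first parameter has a completion whose set has more
  than \<open>N\<close> elements. These conditions become stronger with \<open>N\<close>, so
  saturation gives one first parameter \<open>a\<close> satisfying all of them. Fixing
  \<open>a\<close> leaves \<open>p\<close> parameters, and the induction hypothesis bounds the
  cardinalities, a contradiction.\<close>

lemma uniform_finiteness_if_support:
  assumes "dfn (\<lambda>w. w 0 \<in> D (tsuffix 1 w))"
    and "\<And>v. v \<in> env \<Longrightarrow> D v \<subseteq> carrier M \<and> finite (D v)"
    and "\<And>v v'. v \<in> env \<Longrightarrow> v' \<in> env \<Longrightarrow> (\<And>i. i < p \<Longrightarrow> v i = v' i) \<Longrightarrow> D v = D v'"
  shows "\<exists>N. \<forall>v\<in>env. card (D v) \<le> N"
  using assms
proof (induction p arbitrary: D)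
  case 0
  obtain c where "c \<in> carrier M" using carrier_ne by blast
  then have "(\<lambda>_. c) \<in> env" by (simp add: env_def)
  then have "card (D v) \<le> card (D (\<lambda>_. c))" if "v \<in> env" for v
    using 0(3)[OF that] by simp
  then show ?case by blast
next
  case (Suc p)
  obtain c0 where c0: "c0 \<in> carrier M" using carrier_ne by blast
  \<comment> \<open>The value \<open>c0\<close> fills the entries beyond the first
    \<open>Suc p\<close>, on which \<open>D\<close> does not depend.\<close>
  define ext where "ext = (\<lambda>a y. tjoin 1 (\<lambda>_. a) (tjoin p y (\<lambda>_. c0)) :: nat \<Rightarrow> 'a)"
  have ext: "ext a y \<in> env" if "a \<in> carrier M" "y \<in> tuples M p" for a y
    using that c0 by (auto simp: ext_def tjoin_def env_def tuples_def PiE_def)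
  define Q where "Q = (\<lambda>N a. \<exists>y\<in>tuples M p. \<exists>c\<in>tuples M (Suc N).
    (\<forall>i<Suc N. \<forall>j<Suc N. i \<noteq> j \<longrightarrow> c i \<noteq> c j) \<and> (\<forall>i<Suc N. c i \<in> D (ext a y)))"
  have Q_iff: "Q N a \<longleftrightarrow> (\<exists>y\<in>tuples M p. N < card (D (ext a y)))" if "a \<in> carrier M" for N a
  proof -
    have "(\<exists>c\<in>tuples M (Suc N). (\<forall>i<Suc N. \<forall>j<Suc N. i \<noteq> j \<longrightarrow> c i \<noteq> c j) \<and>
        (\<forall>i<Suc N. c i \<in> D (ext a y))) \<longleftrightarrow> N < card (D (ext a y))" if "y \<in> tuples M p" for y
    proof -
      have "inj_on c {..<Suc N} \<longleftrightarrow> (\<forall>i<Suc N. \<forall>j<Suc N. i \<noteq> j \<longrightarrow> c i \<noteq> c j)" for c :: "nat \<Rightarrow> 'a"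
        unfolding inj_on_def by blast
      then show ?thesis
        using card_gt_iff[of "D (ext a y)" N] Suc.prems(2)[OF ext[OF \<open>a \<in> carrier M\<close> that]]
        by simp
    qed
    then show ?thesis unfolding Q_def by blast
  qed
  have dfn_Q: "dfn (\<lambda>v. Q N (v 0))" for N
  proof -
    \<comment> \<open>In \<open>u\<close> the first \<open>Suc N\<close> entries are the points
      \<open>c\<close>, the next \<open>p\<close> are \<open>y\<close>, and then comes
      \<open>a\<close>.\<close>
    have 1: "dfn (\<lambda>u. u i \<in> D (ext (u (Suc N + p)) (tprefix p (tsuffix (Suc N) u))))"
      if "i < Suc N" for i
    proof (rule dfn_subst[OF Suc.prems(1), of "\<lambda>u k. if k = 0 then u i else
        ext (u (Suc N + p)) (tprefix p (tsuffix (Suc N) u)) (k - 1)"])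
      show "cterm (\<lambda>u. if k = 0 then u i else
        ext (u (Suc N + p)) (tprefix p (tsuffix (Suc N) u)) (k - 1))" for k
        using c0 unfolding ext_def tjoin_def tprefix_def tsuffix_def restrict_def
        by (auto intro!: cterm_if)
    qed (simp add: tsuffix_def)
    have 2: "dfn (\<lambda>u. (\<forall>i\<in>{..<Suc N}. \<forall>j\<in>{..<Suc N}. i \<noteq> j \<longrightarrow> u i \<noteq> u j) \<and>
      (\<forall>i\<in>{..<Suc N}. u i \<in> D (ext (u (Suc N + p)) (tprefix p (tsuffix (Suc N) u)))))"
      by (intro dfn_conj dfn_ball dfn_imp dfn_const dfn_not dfn_eq cterm_var 1) auto
    show ?thesis
      unfolding Q_def
    proof (rule dfn_ex, rule dfn_ex, rule dfn_cong[OF 2])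
      fix v :: "nat \<Rightarrow> 'a"
      have "tsuffix p (tsuffix (Suc N) v) 0 = v (Suc N + p)" by (simp add: tsuffix_def)
      then show "((\<forall>i<Suc N. \<forall>j<Suc N. i \<noteq> j \<longrightarrow> tprefix (Suc N) v i \<noteq> tprefix (Suc N) v j) \<and>
          (\<forall>i<Suc N. tprefix (Suc N) v i \<in>
            D (ext (tsuffix p (tsuffix (Suc N) v) 0) (tprefix p (tsuffix (Suc N) v))))) \<longleftrightarrow>
        ((\<forall>i\<in>{..<Suc N}. \<forall>j\<in>{..<Suc N}. i \<noteq> j \<longrightarrow> v i \<noteq> v j) \<and>
          (\<forall>i\<in>{..<Suc N}. v i \<in> D (ext (v (Suc N + p)) (tprefix p (tsuffix (Suc N) v)))))"
        by (simp add: tprefix_def Ball_def)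
    qed
  qed
  show ?case
  proof (rule ccontr)
    assume "\<not> ?thesis"
    then have unb: "\<exists>v\<in>env. N < card (D v)" for N by (meson not_le)
    have "\<exists>a\<in>carrier M. \<forall>k. Q k a"
    proof (rule saturation[OF dfn_Q])
      fix K
      obtain v where v: "v \<in> env" "K < card (D v)" using unb by blast
      let ?y = "tprefix p (tsuffix 1 v)"
      have y: "?y \<in> tuples M p" and a: "v 0 \<in> carrier M"
        using v(1) by (auto intro: tprefix_tuples env_tsuffix) (simp add: env_def)
      have "D (ext (v 0) ?y) = D v"
      proof (rule Suc.prems(3)[OF ext[OF a y] v(1)])
        fix i assume "i < Suc p"
        then show "ext (v 0) ?y i = v i"
          by (auto simp: ext_def tjoin_def tprefix_def tsuffix_def)
      qed
      then have "k < card (D (ext (v 0) ?y))" if "k \<le> K" for k using v(2) that by simp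
      then show "\<exists>a\<in>carrier M. \<forall>k\<le>K. Q k a" using Q_iff[OF a] a y by blast
    qed
    then obtain a where a: "a \<in> carrier M" "\<And>k. Q k a" by blast
    have env1: "tjoin 1 (\<lambda>_. a) v \<in> env" if "v \<in> env" for v
      using that a(1) by (auto simp: env_def tjoin_def)
    have "\<exists>N. \<forall>v\<in>env. card (D (tjoin 1 (\<lambda>_. a) v)) \<le> N"
    proof (rule Suc.IH)
      show "dfn (\<lambda>w. w 0 \<in> D (tjoin 1 (\<lambda>_. a) (tsuffix 1 w)))"
      proof (rule dfn_subst[OF Suc.prems(1), of "\<lambda>w k. if k = 1 then a else if k = 0 then w 0 else w (k - 1)"])
        fix v :: "nat \<Rightarrow> 'a"
        have "tsuffix 1 (\<lambda>k. if k = 1 then a else if k = 0 then v 0 else v (k - 1)) =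
          tjoin 1 (\<lambda>_. a) (tsuffix 1 v)"
          by (auto simp: tsuffix_def tjoin_def fun_eq_iff)
        then show "v 0 \<in> D (tjoin 1 (\<lambda>_. a) (tsuffix 1 v)) \<longleftrightarrow>
          (if 0 = (1::nat) then a else if (0::nat) = 0 then v 0 else v (0 - 1)) \<in>
            D (tsuffix 1 (\<lambda>k. if k = 1 then a else if k = 0 then v 0 else v (k - 1)))"
          by simp
      qed (use a(1) in \<open>auto intro!: cterm_if\<close>)
      show "D (tjoin 1 (\<lambda>_. a) v) \<subseteq> carrier M \<and> finite (D (tjoin 1 (\<lambda>_. a) v))" if "v \<in> env" for v
        using Suc.prems(2)[OF env1[OF that]] .
      show "D (tjoin 1 (\<lambda>_. a) v) = D (tjoin 1 (\<lambda>_. a) v')"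
        if "v \<in> env" "v' \<in> env" "\<And>i. i < p \<Longrightarrow> v i = v' i" for v v'
        by (rule Suc.prems(3)[OF env1[OF that(1)] env1[OF that(2)]]) (use that(3) in \<open>auto simp: tjoin_def\<close>)
    qed
    then obtain N where N: "\<And>v. v \<in> env \<Longrightarrow> card (D (tjoin 1 (\<lambda>_. a) v)) \<le> N" by blast
    obtain y where y: "y \<in> tuples M p" "N < card (D (ext a y))" using a Q_iff by blast
    have "tjoin p y (\<lambda>_. c0) \<in> env" using y(1) c0 by (intro env_tjoin) (auto simp: env_def)
    from N[OF this] y(2) show False by (simp add: ext_def)
  qed
qed

text \<open>The support hypothesis comes for free: membership reads only the first \<open>p\<close>
  entries of the valuation with the element in front, so \<open>D v\<close> depends on no entry of
  \<open>v\<close> from \<open>p\<close> on.\<close>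

lemma uniform_finiteness:
  assumes D: "dfn (\<lambda>w. w 0 \<in> D (tsuffix 1 w))"
    and fin: "\<And>v. v \<in> env \<Longrightarrow> D v \<subseteq> carrier M \<and> finite (D v)"
  shows "\<exists>N. \<forall>v\<in>env. card (D v) \<le> N"
proof -
  obtain p where p: "\<And>w w'. w \<in> env \<Longrightarrow> w' \<in> env \<Longrightarrow> (\<forall>i<p. w i = w' i) \<Longrightarrow>
    w 0 \<in> D (tsuffix 1 w) \<longleftrightarrow> w' 0 \<in> D (tsuffix 1 w')"
    using dfn_support[OF D] by blast
  have "D v \<subseteq> D v'" if v: "v \<in> env" "v' \<in> env" "\<And>i. i < p \<Longrightarrow> v i = v' i" for v v'
  proof
    fix a assume a: "a \<in> D v"
    then have "a \<in> carrier M" using fin[OF v(1)] by blast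
    then have "tjoin 1 (\<lambda>_. a) v \<in> env" "tjoin 1 (\<lambda>_. a) v' \<in> env"
      using v by (auto simp: env_def tjoin_def)
    from p[OF this] v(3) a show "a \<in> D v'" unfolding tsuffix_tjoin by (simp add: tjoin_def)
  qed
  then show ?thesis by (intro uniform_finiteness_if_support[OF D fin, of p]) (auto, metis subsetD)
qed

subsection \<open>Sets with interior in cartesian powers\<close>

definition basic_box :: "nat \<Rightarrow> (nat \<Rightarrow> 'a) \<Rightarrow> (nat \<Rightarrow> 'a) set" where
  "basic_box d \<beta> = (\<Pi>\<^sub>E i\<in>{..<d}. B (tblock m i \<beta>))"

text \<open>The interior in the product topology, with open sets replaced by codes of basic boxes so
  that quantification is over elements of the model.\<close>

definition box_interior :: "nat \<Rightarrow> (nat \<Rightarrow> 'a) set \<Rightarrow> (nat \<Rightarrow> 'a) set" where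
  "box_interior d D = {y \<in> tuples M d. \<exists>\<beta>\<in>tuples M (d * m). y \<in> basic_box d \<beta> \<and> basic_box d \<beta> \<subseteq> D}"

lemma block_less: "i < d \<Longrightarrow> j < m \<Longrightarrow> i * m + j < d * m"
proof -
  assume "i < d" "j < m"
  then have "i * m + j < Suc i * m" "Suc i * m \<le> d * m" by (auto intro: mult_le_mono1 simp del: mult_Suc) simp
  then show ?thesis by linarith
qed

lemma tblock_tuples: "\<beta> \<in> tuples M (d * m) \<Longrightarrow> i < d \<Longrightarrow> tblock m i \<beta> \<in> tuples M m"
  using block_less[of i d] by (auto simp: tuples_def tblock_def PiE_def)

lemma openin_block: "\<beta> \<in> tuples M (d * m) \<Longrightarrow> i < d \<Longrightarrow> openin \<tau> (B (tblock m i \<beta>))"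
  by (intro openin_B tblock_tuples)

lemma basic_box_tuples: "\<beta> \<in> tuples M (d * m) \<Longrightarrow> basic_box d \<beta> \<subseteq> tuples M d"
  unfolding basic_box_def tuples_def
  using openin_subset[OF openin_block, of \<beta> d] topspace by (intro PiE_mono) (auto simp: tuples_def)

lemma ex_basic_box:
  assumes U: "\<And>i. i < d \<Longrightarrow> openin \<tau> (U i)" and y: "y \<in> (\<Pi>\<^sub>E i\<in>{..<d}. U i)"
  shows "\<exists>\<beta>\<in>tuples M (d * m). y \<in> basic_box d \<beta> \<and> basic_box d \<beta> \<subseteq> (\<Pi>\<^sub>E i\<in>{..<d}. U i)"
proof -
  have "\<forall>i. i < d \<longrightarrow> (\<exists>b\<in>tuples M m. y i \<in> B b \<and> B b \<subseteq> U i)"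
    using U y by (auto intro!: basis_B)
  then obtain b where b: "\<And>i. i < d \<Longrightarrow> b i \<in> tuples M m \<and> y i \<in> B (b i) \<and> B (b i) \<subseteq> U i"
    by metis
  \<comment> \<open>Concatenates the chosen indices: quotient and remainder by \<open>m\<close> give
    the block and the place inside it.\<close>
  define \<beta> where "\<beta> = (\<lambda>k\<in>{..<d * m}. b (k div m) (k mod m))"
  have block: "tblock m i \<beta> = b i" if "i < d" for i
  proof
    fix j
    show "tblock m i \<beta> j = b i j"
      using b[OF that] block_less[OF that, of j]
      by (cases "j < m") (auto simp: tblock_def \<beta>_def tuples_def PiE_def extensional_def)
  qed
  have "\<beta> \<in> tuples M (d * m)"
    unfolding tuples_def \<beta>_def
  proof (rule restrict_PiE_iff[THEN iffD2], rule ballI)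
    fix k assume "k \<in> {..<d * m}"
    then have "k div m < d" "k mod m < m"
      by (auto simp: less_mult_imp_div_less) (metis mod_less_divisor mult_0_right not_gr_zero not_less0)
    then show "b (k div m) (k mod m) \<in> carrier M" using b by (auto simp: tuples_def PiE_def)
  qed
  moreover have "basic_box d \<beta> = (\<Pi>\<^sub>E i\<in>{..<d}. B (b i))" unfolding basic_box_def using block by (intro PiE_cong) auto
  moreover have "y \<in> (\<Pi>\<^sub>E i\<in>{..<d}. B (b i))" using b y by (auto simp: PiE_def)
  moreover have "(\<Pi>\<^sub>E i\<in>{..<d}. B (b i)) \<subseteq> (\<Pi>\<^sub>E i\<in>{..<d}. U i)" using b by (intro PiE_mono) auto
  ultimately show ?thesis by metis
qed

lemma box_interiorI:
  assumes U: "\<And>i. i < d \<Longrightarrow> openin \<tau> (U i)" and y: "y \<in> (\<Pi>\<^sub>E i\<in>{..<d}. U i)"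
    and D: "(\<Pi>\<^sub>E i\<in>{..<d}. U i) \<subseteq> D"
  shows "y \<in> box_interior d D"
proof -
  obtain \<beta> where "\<beta> \<in> tuples M (d * m)" "y \<in> basic_box d \<beta>" "basic_box d \<beta> \<subseteq> (\<Pi>\<^sub>E i\<in>{..<d}. U i)"
    using ex_basic_box[of d U, OF U y] by blast
  then show ?thesis unfolding box_interior_def using basic_box_tuples D by blast
qed

lemma box_interior_subset: "box_interior d D \<subseteq> D"
  by (auto simp: box_interior_def)

lemma box_interior_mono: "D \<subseteq> D' \<Longrightarrow> box_interior d D \<subseteq> box_interior d D'"
  by (auto simp: box_interior_def)

lemma tsolid_iff_box_interior: "tsolid \<tau> d D \<longleftrightarrow> box_interior d D \<noteq> {}"
proof
  assume "tsolid \<tau> d D"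
  then obtain U where U: "\<And>i. i < d \<Longrightarrow> openin \<tau> (U i) \<and> U i \<noteq> {}" "(\<Pi>\<^sub>E i\<in>{..<d}. U i) \<subseteq> D"
    unfolding tsolid_def by blast
  then have "(\<Pi>\<^sub>E i\<in>{..<d}. U i) \<noteq> {}" by (simp add: PiE_eq_empty_iff)
  then show "box_interior d D \<noteq> {}" using box_interiorI[of d U _ D] U by blast
next
  assume "box_interior d D \<noteq> {}"
  then obtain y \<beta> where *: "\<beta> \<in> tuples M (d * m)" "y \<in> basic_box d \<beta>" "basic_box d \<beta> \<subseteq> D"
    unfolding box_interior_def by blast
  have "openin \<tau> (B (tblock m i \<beta>)) \<and> B (tblock m i \<beta>) \<noteq> {}" if "i < d" for i
    using openin_block[OF *(1) that] *(2) that by (auto simp: basic_box_def)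
  then show "tsolid \<tau> d D"
    unfolding tsolid_def using *(3) by (intro exI[of _ "\<lambda>i. B (tblock m i \<beta>)"]) (simp add: basic_box_def)
qed

text \<open>An interior point of the difference would be interior to \<open>D\<close> by
  monotonicity, but such points have been removed.\<close>

lemma not_tsolid_diff_box_interior: "\<not> tsolid \<tau> d (D - box_interior d D)"
  unfolding tsolid_iff_box_interior
  using box_interior_subset[of d "D - box_interior d D"] box_interior_mono[of "D - box_interior d D" D d] by blast

section \<open>Definability of interiors and slices in families\<close>

lemma dfn_in_basic_box:
  assumes "\<And>i. i < d \<Longrightarrow> cterm (\<lambda>w. t w i)" "\<And>i. cterm (\<lambda>w. b w i)"
  shows "dfn (\<lambda>w. tprefix d (t w) \<in> basic_box d (tprefix (d * m) (b w)))"
proof -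
  have "dfn (\<lambda>w. \<forall>i\<in>{..<d}. t w i \<in> B (tprefix m (\<lambda>j. b w (i * m + j))))"
    using assms by (intro dfn_ball dfn_mem_B) auto
  moreover have block: "tblock m i (tprefix (d * m) \<beta>) = tprefix m (\<lambda>j. \<beta> (i * m + j))" if "i < d" for i \<beta>
    using block_less[OF that] by (auto simp: tblock_def tprefix_def fun_eq_iff)
  moreover have "tprefix d (t w) \<in> basic_box d (tprefix (d * m) (b w)) \<longleftrightarrow>
    (\<forall>i\<in>{..<d}. t w i \<in> B (tprefix m (\<lambda>j. b w (i * m + j))))" for w
    by (simp add: basic_box_def PiE_iff block) (simp add: tprefix_def)
  ultimately show ?thesis by simp
qed

lemma dfn_basic_box_subset:
  assumes D: "dfam d D" and \<rho>: "\<And>i. cterm (\<lambda>w. \<rho> w i)" and b: "\<And>i. cterm (\<lambda>w. b w i)"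
  shows "dfn (\<lambda>w. basic_box d (tprefix (d * m) (b w)) \<subseteq> D (\<rho> w))"
proof -
  have suf: "cterm (\<lambda>w. t (tsuffix d w))" if "cterm t" for t
    using cterm_comp[OF that, of "tsuffix d"] by (simp add: tsuffix_def)
  have "dfn (\<lambda>w. tprefix d w \<in> basic_box d (tprefix (d * m) (b (tsuffix d w))) \<longrightarrow>
    tprefix d w \<in> D (\<rho> (tsuffix d w)))"
    using suf[OF \<rho>] suf[OF b] by (intro dfn_imp dfn_in_basic_box dfn_mem[OF D]) auto
  then have "dfn (\<lambda>w. \<forall>z\<in>tuples M d. z \<in> basic_box d (tprefix (d * m) (b w)) \<longrightarrow> z \<in> D (\<rho> w))"
    by (rule dfn_all)
  then show ?thesis
  proof (rule dfn_cong)
    fix w :: "nat \<Rightarrow> 'a" assume "w \<in> env"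
    then have "tprefix (d * m) (b w) \<in> tuples M (d * m)"
      using env_subst[of b, OF b] by (intro tprefix_tuples) auto
    from basic_box_tuples[OF this]
    show "basic_box d (tprefix (d * m) (b w)) \<subseteq> D (\<rho> w) \<longleftrightarrow>
      (\<forall>z\<in>tuples M d. z \<in> basic_box d (tprefix (d * m) (b w)) \<longrightarrow> z \<in> D (\<rho> w))" by blast
  qed
qed

text \<open>This is where definability of the basis matters: interiors of the members of a definable
  family again form a definable family.\<close>

lemma dfam_box_interior:
  assumes "dfam d D"
  shows "dfam d (\<lambda>v. box_interior d (D v))"
proof -
  have "dfn (\<lambda>w. tprefix d (tsuffix (d * m) w) \<in> basic_box d (tprefix (d * m) w) \<and>
    basic_box d (tprefix (d * m) w) \<subseteq> D (tsuffix d (tsuffix (d * m) w)))"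
    by (intro dfn_conj dfn_in_basic_box dfn_basic_box_subset[OF assms]) (auto simp: tsuffix_def)
  then have "dfn (\<lambda>w. \<exists>\<beta>\<in>tuples M (d * m). tprefix d w \<in> basic_box d \<beta> \<and> basic_box d \<beta> \<subseteq> D (tsuffix d w))"
    by (rule dfn_ex)
  then show ?thesis unfolding dfam_def
    by (rule dfn_cong) (simp add: box_interior_def tprefix_tuples)
qed

lemma dfam_slice:
  assumes "dfam (Suc d) D" "\<And>i. cterm (\<lambda>v. \<rho> v i)" "cterm s"
  shows "dfam d (\<lambda>v. tslice d (D (\<rho> v)) (s v))"
proof -
  have suf: "cterm (\<lambda>w. t (tsuffix d w))" if "cterm t" for t
    using cterm_comp[OF that, of "tsuffix d"] by (simp add: tsuffix_def)
  have "dfn (\<lambda>w. tprefix (Suc d) (\<lambda>i. if i < d then w i else s (tsuffix d w)) \<in> D (\<rho> (tsuffix d w)))"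
    using suf[OF assms(2)] suf[OF assms(3)] by (intro dfn_mem[OF assms(1)] cterm_if) auto
  moreover have "tprefix (Suc d) (\<lambda>i. if i < d then w i else a) = (tprefix d w)(d := a)"
    for w :: "nat \<Rightarrow> 'a" and a
    by (auto simp: tprefix_def fun_eq_iff)
  moreover have "tprefix d w \<in> extensional {..<d}" for w :: "nat \<Rightarrow> 'a" by (simp add: tprefix_def)
  ultimately show ?thesis unfolding dfam_def tslice_def by simp
qed

lemma dfam_Int: "dfam d D \<Longrightarrow> dfam d D' \<Longrightarrow> dfam d (\<lambda>v. D v \<inter> D' v)"
  unfolding dfam_def by (auto intro: dfn_conj)

lemma dfam_Un: "dfam d D \<Longrightarrow> dfam d D' \<Longrightarrow> dfam d (\<lambda>v. D v \<union> D' v)"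
  unfolding dfam_def by (auto intro: dfn_disj)

lemma dfam_Diff: "dfam d D \<Longrightarrow> dfam d D' \<Longrightarrow> dfam d (\<lambda>v. D v - D' v)"
  unfolding dfam_def by (auto intro: dfn_conj dfn_not)

lemma dfam_const: "dfam d D \<Longrightarrow> v \<in> env \<Longrightarrow> dfam d (\<lambda>_. D v)"
  unfolding dfam_def[of d "\<lambda>_. D v"]
  by (rule dfn_mem) (auto simp: env_def)

text \<open>As \<open>U\<close> need not be definable, \<open>interior_iff\<close> is applied to a
  non-empty basic set inside it.\<close>

lemma infinite_open: "openin \<tau> U \<Longrightarrow> U \<noteq> {} \<Longrightarrow> infinite U"
proof -
  assume "openin \<tau> U" "U \<noteq> {}"
  then obtain b where b: "b \<in> tuples M m" "B b \<noteq> {}" "B b \<subseteq> U" using basis_B by blast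
  have "dfn (\<lambda>v. v 0 \<in> B (tprefix m b))"
    using b(1) by (intro dfn_mem_B) (auto simp: tuples_def PiE_def)
  moreover have "tprefix m b = b"
    using b(1) by (auto simp: tprefix_def tuples_def PiE_def extensional_def fun_eq_iff)
  moreover have "B b \<subseteq> carrier M" using openin_subset[OF openin_B[OF b(1)]] topspace by simp
  moreover have "\<tau> interior_of B b = B b" using openin_B[OF b(1)] by (simp add: interior_of_openin)
  ultimately have "infinite (B b)" using interior_iff[of "B b"] b(2) by simp
  then show "infinite U" using b(3) finite_subset by blast
qed

text \<open>
  If \<open>y\<close> is interior to infinitely many slices, then it has a single neighbourhood contained in
  infinitely many of them; otherwise uniform finiteness would be violated by the intersections of
  finitely many neighbourhoods of \<open>y\<close>.
\<close>

lemma tsolid_if_infinite_slices: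
  assumes D: "dfam (Suc d) (\<lambda>_. D)" and y: "y \<in> tuples M d"
    and inf: "infinite {s \<in> carrier M. y \<in> box_interior d (tslice d D s)}"
  shows "tsolid \<tau> (Suc d) D"
proof -
  define H where "H = (\<lambda>\<beta>. {s \<in> carrier M. y \<in> basic_box d \<beta> \<and> basic_box d \<beta> \<subseteq> tslice d D s})"
  have py: "tprefix d y = y"
    using y by (auto simp: tprefix_def tuples_def PiE_def extensional_def fun_eq_iff)
  have slice: "dfam d (\<lambda>w. tslice d D (w 0))"
    by (rule dfam_slice[OF D]) auto
  have H: "dfn (\<lambda>w. w 0 \<in> H (tprefix (d * m) (b w)))" if b: "\<And>i. cterm (\<lambda>w. b w i)" for b
  proof -
    have "dfn (\<lambda>w. tprefix d y \<in> basic_box d (tprefix (d * m) (b w)) \<and>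
      basic_box d (tprefix (d * m) (b w)) \<subseteq> tslice d D (w 0))"
      using y b by (intro dfn_conj dfn_in_basic_box dfn_basic_box_subset[OF slice]) (auto simp: tuples_def PiE_def)
    then show ?thesis
      by (rule dfn_cong) (auto simp: H_def py env_def)
  qed
  obtain v where v: "v \<in> env" "infinite (H (tprefix (d * m) v))"
  proof (rule ccontr)
    assume "\<not> thesis"
    then have fin: "finite (H (tprefix (d * m) v))" if "v \<in> env" for v using that \<open>\<And>v. \<lbrakk>v \<in> env; infinite (H (tprefix (d * m) v))\<rbrakk> \<Longrightarrow> thesis\<close> by blast
    obtain N where N: "\<And>v. v \<in> env \<Longrightarrow> card (H (tprefix (d * m) v)) \<le> N"
      using uniform_finiteness[of "\<lambda>v. H (tprefix (d * m) v)"] H[of "tsuffix 1"] fin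
      by (auto simp: tsuffix_def H_def)
    obtain S where S: "S \<subseteq> {s \<in> carrier M. y \<in> box_interior d (tslice d D s)}" "finite S" "card S = Suc N"
      using infinite_arbitrarily_large[OF inf] by blast
    then have "\<forall>s\<in>S. \<exists>\<beta>\<in>tuples M (d * m). y \<in> basic_box d \<beta> \<and> basic_box d \<beta> \<subseteq> tslice d D s"
      unfolding box_interior_def by blast
    then obtain \<beta> where \<beta>: "\<And>s. s \<in> S \<Longrightarrow> \<beta> s \<in> tuples M (d * m) \<and> y \<in> basic_box d (\<beta> s) \<and>
      basic_box d (\<beta> s) \<subseteq> tslice d D s" by metis
    define U where "U = (\<lambda>i. \<Inter>s\<in>S. B (tblock m i (\<beta> s)))"
    have "S \<noteq> {}" using S(3) by auto
    have "openin \<tau> (U i)" if "i < d" for i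
    proof (unfold U_def, rule openin_INT2[OF S(2) \<open>S \<noteq> {}\<close>])
      show "openin \<tau> (B (tblock m i (\<beta> s)))" if "s \<in> S" for s
        using \<beta>[OF that] \<open>i < d\<close> by (intro openin_block) auto
    qed
    moreover have "y \<in> (\<Pi>\<^sub>E i\<in>{..<d}. U i)"
      using \<beta> tuples_ext[OF y] by (auto simp: U_def basic_box_def PiE_def)
    ultimately obtain \<gamma> where \<gamma>: "\<gamma> \<in> tuples M (d * m)" "y \<in> basic_box d \<gamma>" "basic_box d \<gamma> \<subseteq> (\<Pi>\<^sub>E i\<in>{..<d}. U i)"
      using ex_basic_box[of d U y] by blast
    have "S \<subseteq> H \<gamma>"
    proof
      fix s assume s: "s \<in> S"
      then have "(\<Pi>\<^sub>E i\<in>{..<d}. U i) \<subseteq> basic_box d (\<beta> s)"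
        unfolding basic_box_def U_def by (intro PiE_mono) auto
      then have "basic_box d \<gamma> \<subseteq> tslice d D s" using \<beta>[OF s] \<gamma>(3) by blast
      then show "s \<in> H \<gamma>" using \<gamma>(2) s S(1) by (auto simp: H_def)
    qed
    moreover obtain c where c: "c \<in> carrier M" using carrier_ne by blast
    define v where "v = tjoin (d * m) \<gamma> (\<lambda>_. c)"
    have v: "v \<in> env" unfolding v_def by (rule env_tjoin[OF \<gamma>(1)]) (use c in \<open>simp add: env_def\<close>)
    moreover have "tprefix (d * m) v = \<gamma>" using \<gamma>(1) by (simp add: v_def tuples_ext)
    ultimately have "card S \<le> card (H \<gamma>)" "card (H \<gamma>) \<le> N"
      using fin[OF v] N[OF v] by (auto intro: card_mono)
    then show False using S(3) by simp
  qed
  let ?\<beta> = "tprefix (d * m) v"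
  \<comment> \<open>An infinite definable set of elements has interior. The product of the box with
    this interior is the required open box inside \<open>D\<close>.\<close>
  let ?W = "\<tau> interior_of H ?\<beta>"
  have "dfn (\<lambda>w. w 0 \<in> H ?\<beta>)" using v(1) by (intro H) (auto simp: env_def)
  then have W: "?W \<noteq> {}" using interior_iff[of "H ?\<beta>"] v(2) by (auto simp: H_def)
  have \<beta>: "?\<beta> \<in> tuples M (d * m)" using v(1) by (rule tprefix_tuples)
  have y_box: "y \<in> basic_box d ?\<beta>" using v(2) by (auto simp: H_def intro: ccontr)
  define U where "U = (\<lambda>i. if i < d then B (tblock m i ?\<beta>) else ?W)"
  have "openin \<tau> (U i) \<and> U i \<noteq> {}" for i
    using openin_block[OF \<beta>, of i] y_box W by (auto simp: U_def basic_box_def)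
  moreover have "(\<Pi>\<^sub>E i\<in>{..<Suc d}. U i) \<subseteq> D"
  proof
    fix x assume x: "x \<in> (\<Pi>\<^sub>E i\<in>{..<Suc d}. U i)"
    then have "x d \<in> U d" by blast
    then have "x d \<in> H ?\<beta>" using interior_of_subset[of \<tau> "H ?\<beta>"] by (auto simp: U_def)
    then have "basic_box d ?\<beta> \<subseteq> tslice d D (x d)" by (simp add: H_def)
    moreover have "tprefix d x \<in> basic_box d ?\<beta>"
      unfolding basic_box_def tprefix_def[of d x]
    proof (rule restrict_PiE_iff[THEN iffD2], rule ballI)
      fix i assume "i \<in> {..<d}"
      then show "x i \<in> B (tblock m i ?\<beta>)" using PiE_mem[OF x, of i] by (simp add: U_def)
    qed
    moreover have "x \<in> extensional {..<Suc d}" using x by (simp only: PiE_iff)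
    then have "(tprefix d x)(d := x d) = x"
      by (auto simp: tprefix_def fun_eq_iff extensional_def)
    ultimately show "x \<in> D" by (auto simp: tslice_def)
  qed
  ultimately show ?thesis unfolding tsolid_def by blast
qed

section \<open>Finite sets escaping thin families, and unions of thin sets\<close>

definition finitely_escapable :: "nat \<Rightarrow> bool" where
  "finitely_escapable d \<longleftrightarrow> (\<forall>D U. dfam d D \<longrightarrow> (\<forall>v\<in>env. \<not> tsolid \<tau> d (D v)) \<longrightarrow>
     (\<forall>i<d. openin \<tau> (U i) \<and> U i \<noteq> {}) \<longrightarrow>
     (\<exists>F. finite F \<and> F \<subseteq> (\<Pi>\<^sub>E i\<in>{..<d}. U i) \<and> (\<forall>v\<in>env. \<not> F \<subseteq> D v)))"

lemma finitely_escapableD: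
  assumes "finitely_escapable d" "dfam d D" "\<And>v. v \<in> env \<Longrightarrow> \<not> tsolid \<tau> d (D v)"
    and "\<And>i. i < d \<Longrightarrow> openin \<tau> (U i) \<and> U i \<noteq> {}"
  obtains F where "finite F" "F \<subseteq> (\<Pi>\<^sub>E i\<in>{..<d}. U i)" "\<And>v. v \<in> env \<Longrightarrow> \<not> F \<subseteq> D v"
proof -
  have "\<exists>F. finite F \<and> F \<subseteq> (\<Pi>\<^sub>E i\<in>{..<d}. U i) \<and> (\<forall>v\<in>env. \<not> F \<subseteq> D v)"
    using assms(1)[unfolded finitely_escapable_def, THEN spec[of _ D], THEN spec[of _ U]]
    by (simp add: assms(2-4))
  then obtain F where F: "finite F" "F \<subseteq> (\<Pi>\<^sub>E i\<in>{..<d}. U i)" "\<forall>v\<in>env. \<not> F \<subseteq> D v"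
    by (elim exE conjE)
  show ?thesis by (rule that[OF F(1,2)], rule bspec[OF F(3)])
qed

definition tsolid_prime :: "nat \<Rightarrow> bool" where
  "tsolid_prime d \<longleftrightarrow> (\<forall>D E. dfam d (\<lambda>_. D) \<longrightarrow> dfam d (\<lambda>_. E) \<longrightarrow> tsolid \<tau> d (D \<union> E) \<longrightarrow>
     tsolid \<tau> d D \<or> tsolid \<tau> d E)"

lemma PiE_Suc_upd: "y \<in> (\<Pi>\<^sub>E i\<in>{..<d}. U i) \<Longrightarrow> s \<in> U d \<Longrightarrow> y(d := s) \<in> (\<Pi>\<^sub>E i\<in>{..<Suc d}. U i)"
  by (auto simp: PiE_def extensional_def less_Suc_eq)

text \<open>For fixed \<open>y\<close>, only finitely many slices of a thin set have
  \<open>y\<close> in their interior, with a uniform bound \<open>N\<close>. Slices without their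
  interiors form a thin family, so some finite \<open>F\<close> in the base escapes it. If
  \<open>D v\<close> contained the product of \<open>F\<close> with a set \<open>S\<close>, every
  \<open>s\<close> in \<open>S\<close> would have a point of \<open>F\<close> interior to its slice,
  so \<open>S\<close> would have at most \<open>card F * N\<close> elements.\<close>

lemma finitely_escapable_Suc:
  assumes "finitely_escapable d"
  shows "finitely_escapable (Suc d)"
  unfolding finitely_escapable_def
proof (intro allI impI)
  fix D U
  assume D: "dfam (Suc d) D" and thin: "\<forall>v\<in>env. \<not> tsolid \<tau> (Suc d) (D v)"
    and U: "\<forall>i<Suc d. openin \<tau> (U i) \<and> U i \<noteq> {}"
  define H where "H = (\<lambda>v. {s \<in> carrier M. tprefix d v \<in> box_interior d (tslice d (D (tsuffix d v)) s)})"
  have fin: "finite (H v)" if v: "v \<in> env" for v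
  proof (rule ccontr)
    assume "infinite (H v)"
    then have "tsolid \<tau> (Suc d) (D (tsuffix d v))"
      using tsolid_if_infinite_slices[OF dfam_const[OF D env_tsuffix[OF v]] tprefix_tuples[OF v]]
      by (simp add: H_def)
    then show False using thin env_tsuffix[OF v] by blast
  qed
  have sl: "dfam d (\<lambda>w. tslice d (D (tsuffix 1 w)) (w 0))"
    by (rule dfam_slice[OF D]) (auto simp: tsuffix_def)
  have "dfn (\<lambda>w. w 0 \<in> H (tsuffix 1 w))"
  proof -
    \<comment> \<open>In \<open>w\<close>, entry 0 is the height \<open>s\<close> of the slice, the
      next \<open>d\<close> entries are \<open>y\<close>, and the rest are the parameters of
      \<open>D\<close>.\<close>
    have "dfn (\<lambda>w. tprefix d (tsuffix 1 w) \<in> box_interior d (tslice d (D (tsuffix 1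
      (\<lambda>i. if i = 0 then w 0 else w (d + i)))) (if (0::nat) = 0 then w 0 else w (d + 0))))"
      by (rule dfn_mem[OF dfam_box_interior[OF sl]]) (auto simp: tsuffix_def intro: cterm_if)
    moreover have "tsuffix 1 (\<lambda>i. if i = 0 then w 0 else w (d + i)) = tsuffix d (tsuffix 1 w)"
      for w :: "nat \<Rightarrow> 'a"
      by (auto simp: tsuffix_def)
    ultimately show ?thesis by (rule_tac dfn_cong) (auto simp: H_def env_def)
  qed
  then obtain N where N: "\<And>v. v \<in> env \<Longrightarrow> card (H v) \<le> N"
    using uniform_finiteness[of H] fin by (auto simp: H_def)
  define E where "E = (\<lambda>w. tslice d (D (tsuffix 1 w)) (w 0) - box_interior d (tslice d (D (tsuffix 1 w)) (w 0)))"
  have "dfam d E" unfolding E_def by (intro dfam_Diff dfam_box_interior sl)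
  moreover have "\<not> tsolid \<tau> d (E w)" for w unfolding E_def by (rule not_tsolid_diff_box_interior)
  ultimately obtain F where F: "finite F" "F \<subseteq> (\<Pi>\<^sub>E i\<in>{..<d}. U i)" "\<And>w. w \<in> env \<Longrightarrow> \<not> F \<subseteq> E w"
    using U by (elim finitely_escapableD[OF assms, of E U]) auto
  have Ud: "U d \<subseteq> carrier M" "infinite (U d)"
    using U openin_subset[of \<tau> "U d"] topspace infinite_open[of "U d"] by auto
  obtain S where S: "S \<subseteq> U d" "finite S" "card S = Suc (card F * N)"
    using infinite_arbitrarily_large[OF Ud(2)] by blast
  have FM: "F \<subseteq> tuples M d"
  proof -
    have "(\<Pi>\<^sub>E i\<in>{..<d}. U i) \<subseteq> tuples M d"
      unfolding tuples_def using U openin_subset[of \<tau>] topspace by (intro PiE_mono) auto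
    then show ?thesis using F(2) by blast
  qed
  let ?F = "(\<lambda>(y, s). y(d := s)) ` (F \<times> S)"
  have "\<not> ?F \<subseteq> D v" if v: "v \<in> env" for v
  proof
    assume sub: "?F \<subseteq> D v"
    have "S \<subseteq> (\<Union>y\<in>F. H (tjoin d y v))"
    proof
      fix s assume s: "s \<in> S"
      let ?w = "tjoin 1 (\<lambda>_. s) v"
      have w: "?w \<in> env" using s S Ud v by (auto simp: env_def tjoin_def)
      have [simp]: "?w 0 = s" by (simp add: tjoin_def)
      have "F \<subseteq> tslice d (D v) s" using sub s FM by (auto simp: tslice_def tuples_ext)
      then obtain y where y: "y \<in> F" "y \<in> box_interior d (tslice d (D v) s)"
        using F(3)[OF w] by (auto simp: E_def simp del: One_nat_def)
      then have "s \<in> H (tjoin d y v)"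
        using s S Ud FM by (auto simp: H_def tuples_ext subset_iff)
      then show "s \<in> (\<Union>y\<in>F. H (tjoin d y v))" using y by blast
    qed
    moreover have env: "tjoin d y v \<in> env" if "y \<in> F" for y
      using that FM v env_tjoin by blast
    ultimately have "card S \<le> card (\<Union>y\<in>F. H (tjoin d y v))"
      using F(1) fin by (intro card_mono) auto
    also have "\<dots> \<le> (\<Sum>y\<in>F. card (H (tjoin d y v)))" by (rule card_UN_le[OF F(1)])
    also have "\<dots> \<le> (\<Sum>y\<in>F. N)" using N env by (intro sum_mono) auto
    finally show False using S(3) by simp
  qed
  moreover have "?F \<subseteq> (\<Pi>\<^sub>E i\<in>{..<Suc d}. U i)"
  proof (rule image_subsetI, clarify)
    fix y s assume "y \<in> F" "s \<in> S"
    then show "y(d := s) \<in> (\<Pi>\<^sub>E i\<in>{..<Suc d}. U i)"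
      by (intro PiE_Suc_upd subsetD[OF F(2)] subsetD[OF S(1)])
  qed
  moreover have "finite ?F" using F(1) S(2) by simp
  ultimately show "\<exists>F. finite F \<and> F \<subseteq> (\<Pi>\<^sub>E i\<in>{..<Suc d}. U i) \<and> (\<forall>v\<in>env. \<not> F \<subseteq> D v)"
    by blast
qed

text \<open>Points of the slices that are interior to neither the slice of \<open>D\<close> nor that
  of \<open>E\<close> form a family that is thin by primeness in dimension \<open>d\<close>. A
  finite \<open>F\<close> escapes it, so each height in the infinite set \<open>U d\<close> has a
  point of \<open>F\<close> interior to one of the two slices. By pigeonhole one point of
  \<open>F\<close> and one of the two sets serve infinitely many heights.\<close>

lemma tsolid_prime_Suc:
  assumes "finitely_escapable d" "tsolid_prime d"
  shows "tsolid_prime (Suc d)"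
  unfolding tsolid_prime_def
proof (intro allI impI)
  fix D E
  assume D: "dfam (Suc d) (\<lambda>_. D)" and E: "dfam (Suc d) (\<lambda>_. E)" and "tsolid \<tau> (Suc d) (D \<union> E)"
  then obtain U where U: "\<forall>i<Suc d. openin \<tau> (U i) \<and> U i \<noteq> {}" "(\<Pi>\<^sub>E i\<in>{..<Suc d}. U i) \<subseteq> D \<union> E"
    unfolding tsolid_def by blast
  define P where "P = (\<lambda>w :: nat \<Rightarrow> 'a. tslice d D (w 0) - box_interior d (tslice d D (w 0)) - box_interior d (tslice d E (w 0)))"
  define Q where "Q = (\<lambda>w :: nat \<Rightarrow> 'a. tslice d E (w 0) - box_interior d (tslice d D (w 0)) - box_interior d (tslice d E (w 0)))"
  have sl: "dfam d (\<lambda>w. tslice d D (w 0))" "dfam d (\<lambda>w. tslice d E (w 0))"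
    by (rule dfam_slice[OF D] dfam_slice[OF E]; auto)+
  have PQ: "dfam d P" "dfam d Q"
    unfolding P_def Q_def by (intro dfam_Diff dfam_box_interior sl)+
  have thin: "\<not> tsolid \<tau> d (P w \<union> Q w)" if w: "w \<in> env" for w
  proof
    assume "tsolid \<tau> d (P w \<union> Q w)"
    then have "tsolid \<tau> d (P w) \<or> tsolid \<tau> d (Q w)"
      using assms(2) dfam_const[OF PQ(1) w] dfam_const[OF PQ(2) w] unfolding tsolid_prime_def by blast
    then have "tsolid \<tau> d (tslice d D (w 0) - box_interior d (tslice d D (w 0))) \<or>
      tsolid \<tau> d (tslice d E (w 0) - box_interior d (tslice d E (w 0)))"
      by (auto simp: P_def Q_def intro: tsolid_mono)
    then show False by (simp add: not_tsolid_diff_box_interior)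
  qed
  obtain F where F: "finite F" "F \<subseteq> (\<Pi>\<^sub>E i\<in>{..<d}. U i)" "\<And>w. w \<in> env \<Longrightarrow> \<not> F \<subseteq> P w \<union> Q w"
    by (rule finitely_escapableD[OF assms(1) dfam_Un[OF PQ] thin, of U]) (use U(1) in auto)
  have Ud: "U d \<subseteq> carrier M" "infinite (U d)"
    using U openin_subset[of \<tau> "U d"] topspace infinite_open[of "U d"] by auto
  have FM: "F \<subseteq> tuples M d"
  proof -
    have "(\<Pi>\<^sub>E i\<in>{..<d}. U i) \<subseteq> tuples M d"
      unfolding tuples_def using U openin_subset[of \<tau>] topspace by (intro PiE_mono) auto
    then show ?thesis using F(2) by blast
  qed
  let ?D = "\<lambda>y. {s \<in> carrier M. y \<in> box_interior d (tslice d D s)}"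
  let ?E = "\<lambda>y. {s \<in> carrier M. y \<in> box_interior d (tslice d E s)}"
  have "U d \<subseteq> (\<Union>y\<in>F. ?D y \<union> ?E y)"
  proof
    fix s assume s: "s \<in> U d"
    then have "(\<lambda>_. s) \<in> env" using Ud by (auto simp: env_def)
    then obtain y where y: "y \<in> F" "y \<notin> P (\<lambda>_. s) \<union> Q (\<lambda>_. s)" using F(3) by blast
    have "y(d := s) \<in> (\<Pi>\<^sub>E i\<in>{..<Suc d}. U i)" using F(2) y(1) s by (intro PiE_Suc_upd) auto
    then have "y \<in> tslice d D s \<union> tslice d E s"
      using U(2) y(1) FM by (auto simp: tslice_def tuples_ext subset_iff)
    then have "y \<in> box_interior d (tslice d D s) \<union> box_interior d (tslice d E s)"
      using y(2) by (auto simp: P_def Q_def)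
    then show "s \<in> (\<Union>y\<in>F. ?D y \<union> ?E y)" using y(1) s Ud by auto
  qed
  then have "infinite (\<Union>y\<in>F. ?D y \<union> ?E y)" using Ud(2) finite_subset by blast
  then obtain y where "y \<in> F" "infinite (?D y) \<or> infinite (?E y)" using F(1) by auto
  then show "tsolid \<tau> (Suc d) D \<or> tsolid \<tau> (Suc d) E"
    using tsolid_if_infinite_slices[OF D, of y] tsolid_if_infinite_slices[OF E, of y] FM by blast
qed

text \<open>The induction is joint because the step for primeness uses escapability one dimension
  lower. In dimension 0 the only tuple is the empty one, and a thin set does not contain it.\<close>

lemma finitely_escapable_and_prime: "finitely_escapable d \<and> tsolid_prime d"
proof (induction d)
  case 0
  have "tsolid \<tau> 0 D \<longleftrightarrow> (\<lambda>_. undefined) \<in> D" for D :: "(nat \<Rightarrow> 'a) set"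
    by (simp add: tsolid_def)
  then show ?case
    unfolding finitely_escapable_def tsolid_prime_def by auto
next
  case (Suc d)
  then show ?case using finitely_escapable_Suc tsolid_prime_Suc by blast
qed

lemma tsolid_Un:
  assumes "dfam d (\<lambda>_. D)" "dfam d (\<lambda>_. E)" "tsolid \<tau> d (D \<union> E)"
  shows "tsolid \<tau> d D \<or> tsolid \<tau> d E"
  using finitely_escapable_and_prime[of d] assms unfolding tsolid_prime_def by blast

lemmas finite_escape = finitely_escapableD[OF finitely_escapable_and_prime[THEN conjunct1]]

end

subsection \<open>Monster models of t-minimal theories\<close>

text \<open>Each formula uses finitely many parameters, so only countably many occur in total; this
  is at most the number of formulas and hence less than \<open>\<kappa>\<close>.\<close>

lemma saturated_countable:
  assumes M: "saturated L \<kappa> M" and card: "Card_order \<kappa>" "|formulas L| <o \<kappa>"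
    and f: "\<And>k. \<phi> k \<in> formulas L" and e: "\<And>k. range (e k) \<subseteq> carrier M"
    and fin: "\<And>K. \<exists>a\<in>carrier M. \<forall>k\<le>K. sat M ((e k)(0 := a)) (\<phi> k)"
  shows "\<exists>a\<in>carrier M. \<forall>k::nat. sat M ((e k)(0 := a)) (\<phi> k)"
proof -
  define A where "A = (\<Union>k. e k ` fv (\<phi> k))"
  define p where "p = range (\<lambda>k. (\<phi> k, e k))"
  have "countable (e k ` fv (\<phi> k))" for k by (intro countable_finite finite_imageI finite_fv)
  then have "countable A" by (simp add: A_def)
  then have "|A| \<le>o |UNIV :: nat set|" 
    using card_of_ordLeq[of A "UNIV :: nat set"] by (auto simp: countable_def)
  also have "|UNIV :: nat set| \<le>o |formulas L|"
    using infinite_formulas infinite_iff_card_of_nat by blast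
  finally have A: "|A| <o \<kappa>" using card(2) ordLeq_ordLess_trans by blast
  have "\<exists>a\<in>carrier M. \<forall>(\<phi>, e)\<in>q. sat M (e(0 := a)) \<phi>" if q: "finite q" "q \<subseteq> p" for q
  proof -
    obtain I where I: "finite I" "q = (\<lambda>k. (\<phi> k, e k)) ` I"
      using finite_subset_image[of q "\<lambda>k. (\<phi> k, e k)" UNIV] q unfolding p_def by blast
    obtain K where "\<And>k. k \<in> I \<Longrightarrow> k \<le> K" using I(1) by (meson finite_nat_set_iff_bounded_le)
    then show ?thesis using fin[of K] I(2) by auto
  qed
  moreover have "\<forall>(\<phi>, e)\<in>p. \<phi> \<in> formulas L \<and> e ` (fv \<phi> - {0}) \<subseteq> A"
    using f by (auto simp: p_def A_def)
  moreover have "A \<subseteq> carrier M" using e by (auto simp: A_def)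
  ultimately have "\<exists>a\<in>carrier M. \<forall>(\<phi>, e)\<in>p. sat M (e(0 := a)) \<phi>"
    using M[unfolded saturated_def, rule_format, of A p] A by blast
  then show ?thesis by (auto simp: p_def)
qed

context fo_model
begin

lemma dfn_sat: "wf_fm L \<phi> \<Longrightarrow> (\<And>i. cterm (\<lambda>v. \<rho> v i)) \<Longrightarrow> dfn (\<lambda>v. sat M (\<rho> v) \<phi>)"
  unfolding dfn_def by blast

lemma definable_1_if_dfn:
  assumes "dfn (\<lambda>v. Q (v 0))"
  shows "definable L M 1 {x \<in> tuples M 1. Q (x 0)}"
proof (rule definable_if_dfn)
  show "dfn (\<lambda>v. tprefix 1 v \<in> {x \<in> tuples M 1. Q (x 0)})"
    using assms by (rule dfn_cong) (auto simp: tprefix_def tuples_def env_def)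
qed auto

end

lemma tame_model_of_monster:
  fixes M :: "('a, 'f, 'r) fo_struct"
  assumes t: "t_minimal_by L T \<T>" and mm: "monster_model L T \<kappa> M"
  obtains m B where "tame_model L M (\<T> M) m B"
proof -
  have model: "is_model L T M" and card: "Card_order \<kappa>" "|formulas L| <o \<kappa>" and sat: "saturated L \<kappa> M"
    using mm by (auto simp: monster_model_def)
  obtain m \<phi> \<psi> where f: "\<phi> \<in> formulas L" "\<psi> \<in> formulas L"
    and all: "\<forall>M. is_model L T M \<longrightarrow> topspace (\<T> M) = carrier M \<and> Hausdorff_space (\<T> M) \<and>
      (\<exists>e. range e \<subseteq> carrier M \<and> topology_basis (\<T> M) (family_of M m \<phi> \<psi> e)) \<and>
      (\<forall>D. definable1 L M D \<longrightarrow> (\<T> M interior_of D \<noteq> {} \<longleftrightarrow> infinite D))"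
    using t unfolding t_minimal_by_def by (elim exE bexE)
  obtain e where top: "topspace (\<T> M) = carrier M"
    and hd: "Hausdorff_space (\<T> M)" and e: "range e \<subseteq> carrier M"
    and basis: "topology_basis (\<T> M) (family_of M m \<phi> \<psi> e)"
    and int: "\<forall>D. definable1 L M D \<longrightarrow> (\<T> M interior_of D \<noteq> {} \<longleftrightarrow> infinite D)"
    using all[THEN spec[of _ M], THEN mp, OF model] by (elim conjE exE)
  interpret fo_model L M
    using model by unfold_locales (auto simp: is_model_def is_structure_def)
  \<comment> \<open>Requiring \<open>\<psi>\<close> makes \<open>B b\<close> empty, hence still
    open, for tuples outside the index set, so that all \<open>m\<close>-tuples can serve as
    indices.\<close>
  define B where "B = (\<lambda>b. {a \<in> carrier M. sat M (with_params m b e) \<psi> \<and>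
    sat M ((with_params m b e)(m := a)) \<phi>})"
  have fam: "family_of M m \<phi> \<psi> e = B ` {b \<in> tuples M m. sat M (with_params m b e) \<psi>}"
    unfolding family_of_def B_def by (intro image_cong) auto
  have "tame_model L M (\<T> M) m B"
  proof unfold_locales
    fix Q :: "nat \<Rightarrow> 'a \<Rightarrow> bool"
    assume Q: "\<And>k. dfn (\<lambda>v. Q k (v 0))" and fin: "\<And>K. \<exists>a\<in>carrier M. \<forall>k\<le>K. Q k a"
    have "\<exists>\<phi> e. \<phi> \<in> formulas L \<and> range e \<subseteq> carrier M \<and>
      (\<forall>a\<in>carrier M. Q k a \<longleftrightarrow> sat M (e(0 := a)) \<phi>)" for k
    proof -
      obtain \<phi> e where *: "\<phi> \<in> formulas L" "range e \<subseteq> carrier M"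
        "{x \<in> tuples M 1. Q k (x 0)} = {x \<in> tuples M 1. sat M (with_params 1 x e) \<phi>}"
        using definable_1_if_dfn[OF Q] unfolding definable_def by blast
      have "Q k a \<longleftrightarrow> sat M (e(0 := a)) \<phi>" if a: "a \<in> carrier M" for a
      proof -
        have "(\<lambda>i\<in>{..<1}. a) \<in> tuples M 1" using a by (auto simp: tuples_def)
        moreover have "with_params 1 (\<lambda>i\<in>{..<1}. a) e = e(0 := a)"
          by (auto simp: with_params_def fun_eq_iff)
        ultimately show ?thesis using eqset_imp_iff[OF *(3), of "\<lambda>i\<in>{..<1}. a"] by simp
      qed
      then show ?thesis using * by blast
    qed
    then obtain \<phi> e where *: "\<And>k. \<phi> k \<in> formulas L" "\<And>k. range (e k) \<subseteq> carrier M"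
      "\<And>k a. a \<in> carrier M \<Longrightarrow> Q k a \<longleftrightarrow> sat M ((e k)(0 := a)) (\<phi> k)" by metis
    have "\<exists>a\<in>carrier M. \<forall>k. sat M ((e k)(0 := a)) (\<phi> k)"
      by (rule saturated_countable[OF sat card *(1,2)]) (use fin *(3) in blast)
    then show "\<exists>a\<in>carrier M. \<forall>k. Q k a" using *(3) by blast
  next
    show "openin (\<T> M) (B b)" if "b \<in> tuples M m" for b
    proof (cases "sat M (with_params m b e) \<psi>")
      case True
      then show ?thesis using basis that unfolding topology_basis_def fam by blast
    next
      case False
      then have "B b = {}" by (simp add: B_def)
      then show ?thesis by simp
    qed
    show "\<exists>b\<in>tuples M m. x \<in> B b \<and> B b \<subseteq> V" if "openin (\<T> M) V" "x \<in> V" for V x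
      using basis that unfolding topology_basis_def fam by blast
    have "dfn (\<lambda>v. sat M (with_params m v e) \<psi> \<and> sat M ((with_params m v e)(m := v m)) \<phi>)"
    proof (intro dfn_conj dfn_sat)
      show "cterm (\<lambda>v. with_params m v e i)" for i
        using e by (cases "i < m") (auto simp: with_params_def)
      then show "cterm (\<lambda>v. ((with_params m v e)(m := v m)) i)" for i
        by (cases "i = m") auto
    qed (use f in \<open>auto simp: formulas_def\<close>)
    moreover have "with_params m (tprefix m v) e = with_params m v e" for v
      by (auto simp: with_params_def tprefix_def)
    ultimately show "dfn (\<lambda>v. v m \<in> B (tprefix m v))"
      by (rule_tac dfn_cong) (auto simp: B_def env_def)
    show "\<T> M interior_of D \<noteq> {} \<longleftrightarrow> infinite D" if "D \<subseteq> carrier M" "dfn (\<lambda>v. v 0 \<in> D)" for D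
      using definable_1_if_dfn[OF that(2)] that(1) by (intro int[rule_format]) (simp add: definable1_def)
  qed (fact top hd)+
  then show ?thesis by (rule that)
qed

section \<open>Dimension through coordinate projections\<close>

definition proj_dims :: "'a topology \<Rightarrow> nat \<Rightarrow> (nat \<Rightarrow> 'a) set \<Rightarrow> nat set" where
  "proj_dims \<tau> n X = {k. k \<le> n \<and> (\<exists>s. strict_mono_on {..<k} s \<and> s ` {..<k} \<subseteq> {..<n} \<and>
     tsolid \<tau> k (coord_proj k s ` X))}"

lemma dim_eq: "X \<noteq> {} \<Longrightarrow> dim \<tau> n X = ereal (real (Max (proj_dims \<tau> n X)))"
  by (simp add: dim_def proj_dims_def tsolid_iff)

lemma finite_proj_dims: "finite (proj_dims \<tau> n X)"
  by (rule finite_subset[of _ "{..n}"]) (auto simp: proj_dims_def)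

lemma proj_dims_mono: "X \<subseteq> Y \<Longrightarrow> proj_dims \<tau> n X \<subseteq> proj_dims \<tau> n Y"
  unfolding proj_dims_def by (blast intro: tsolid_mono image_mono)

lemma zero_in_proj_dims: "X \<noteq> {} \<Longrightarrow> 0 \<in> proj_dims \<tau> n X"
proof -
  assume "X \<noteq> {}"
  then have "tsolid \<tau> 0 (coord_proj 0 id ` X)"
    by (auto simp: tsolid_def coord_proj_def restrict_def image_iff)
  then show ?thesis unfolding proj_dims_def by (auto intro!: exI[of _ id] simp: strict_mono_on_def)
qed

text \<open>One inequality is monotonicity; for the other it suffices that the largest projection
  dimension of \<open>Y\<close> is attained by \<open>X\<close>.\<close>

lemma dim_eq_if_proj_dims:
  assumes "X \<subseteq> Y" "X \<noteq> {}" "Max (proj_dims \<tau> n Y) \<in> proj_dims \<tau> n X"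
  shows "dim \<tau> n X = dim \<tau> n Y"
proof -
  have "Max (proj_dims \<tau> n X) \<le> Max (proj_dims \<tau> n Y)"
    using assms by (intro Max_mono proj_dims_mono finite_proj_dims) auto
  moreover have "Max (proj_dims \<tau> n Y) \<le> Max (proj_dims \<tau> n X)"
    using assms by (intro Max_ge finite_proj_dims)
  ultimately show ?thesis using assms(1,2) dim_eq[of X \<tau> n] dim_eq[of Y \<tau> n] by (metis antisym subset_empty)
qed

subsection \<open>Definable abelian groups\<close>

context tame_model
begin

lemma dfam_definable: "definable L M n X \<Longrightarrow> dfam n (\<lambda>_. X)"
  unfolding dfam_def by (rule dfn_if_definable)

lemma definable_dfam: "dfam n (\<lambda>_. X) \<Longrightarrow> X \<subseteq> tuples M n \<Longrightarrow> definable L M n X"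
  unfolding dfam_def by (rule definable_if_dfn)

lemma dfam_proj:
  assumes D: "dfam n D" and sub: "\<And>v. D v \<subseteq> tuples M n" and s: "s ` {..<d} \<subseteq> {..<n}"
  shows "dfam d (\<lambda>v. coord_proj d s ` D v)"
proof -
  have "dfn (\<lambda>w. tprefix n w \<in> D (tsuffix d (tsuffix n w)) \<and> (\<forall>i\<in>{..<d}. w (s i) = w (n + i)))"
    by (intro dfn_conj dfn_mem[OF D] dfn_ball dfn_eq) (auto simp: tsuffix_def)
  then have "dfn (\<lambda>w. tprefix n w \<in> D (tsuffix d (tsuffix n w)) \<and>
      tprefix d (tsuffix n w) = coord_proj d s (tprefix n w))"
  proof (rule dfn_cong)
    fix w :: "nat \<Rightarrow> 'a"
    have "tprefix d (tsuffix n w) = coord_proj d s (tprefix n w) \<longleftrightarrow> (\<forall>i\<in>{..<d}. w (s i) = w (n + i))"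
      using s by (auto simp: tprefix_def tsuffix_def coord_proj_def fun_eq_iff restrict_def image_subset_iff)
    then show "(tprefix n w \<in> D (tsuffix d (tsuffix n w)) \<and>
        tprefix d (tsuffix n w) = coord_proj d s (tprefix n w)) \<longleftrightarrow>
      (tprefix n w \<in> D (tsuffix d (tsuffix n w)) \<and> (\<forall>i\<in>{..<d}. w (s i) = w (n + i)))" by blast
  qed
  then have "dfn (\<lambda>w. \<exists>x\<in>tuples M n. x \<in> D (tsuffix d w) \<and> tprefix d w = coord_proj d s x)"
    by (rule dfn_ex)
  then show ?thesis unfolding dfam_def
    by (rule dfn_cong) (use sub in blast)
qed

text \<open>The graph only compares entries below \<open>n\<close>; since group elements are
  extensional, agreement there is equality.\<close>

lemma mult_graph_iff:
  assumes "carrier G \<subseteq> tuples M n" "\<And>x y. x \<in> carrier G \<Longrightarrow> y \<in> carrier G \<Longrightarrow> x \<otimes>\<^bsub>G\<^esub> y \<in> carrier G"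
  shows "tprefix (3 * n) t \<in> mult_graph n G \<longleftrightarrow> tprefix n t \<in> carrier G \<and>
    tprefix n (tsuffix n t) \<in> carrier G \<and>
    tprefix n (tsuffix (2 * n) t) = tprefix n t \<otimes>\<^bsub>G\<^esub> tprefix n (tsuffix n t)"
proof
  have eqI: "tprefix n u = x" if "x \<in> carrier G" "\<And>i. i < n \<Longrightarrow> u i = x i" for u x
    using that assms(1) tuples_ext[of x M n] by (auto simp: tprefix_def fun_eq_iff extensional_def)
  assume "tprefix (3 * n) t \<in> mult_graph n G"
  then obtain x y where xy: "x \<in> carrier G" "y \<in> carrier G"
    "\<And>i. i < n \<Longrightarrow> t i = x i \<and> t (n + i) = y i \<and> t (2 * n + i) = (x \<otimes>\<^bsub>G\<^esub> y) i"
    unfolding mult_graph_def by (auto simp: tprefix_def)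
  then have "tprefix n t = x" "tprefix n (tsuffix n t) = y" "tprefix n (tsuffix (2 * n) t) = x \<otimes>\<^bsub>G\<^esub> y"
    using assms(2) by (auto intro!: eqI simp: tsuffix_def)
  then show "tprefix n t \<in> carrier G \<and> tprefix n (tsuffix n t) \<in> carrier G \<and>
    tprefix n (tsuffix (2 * n) t) = tprefix n t \<otimes>\<^bsub>G\<^esub> tprefix n (tsuffix n t)" using xy by simp
next
  assume *: "tprefix n t \<in> carrier G \<and> tprefix n (tsuffix n t) \<in> carrier G \<and>
    tprefix n (tsuffix (2 * n) t) = tprefix n t \<otimes>\<^bsub>G\<^esub> tprefix n (tsuffix n t)"
  have "\<forall>i<n. tprefix (3 * n) t i = tprefix n t i \<and> tprefix (3 * n) t (n + i) = tprefix n (tsuffix n t) i \<and>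
    tprefix (3 * n) t (2 * n + i) = (tprefix n t \<otimes>\<^bsub>G\<^esub> tprefix n (tsuffix n t)) i"
    unfolding *[THEN conjunct2, THEN conjunct2, symmetric]
    by (simp add: tprefix_def tsuffix_def)
  then show "tprefix (3 * n) t \<in> mult_graph n G"
    unfolding mult_graph_def using *
    by (intro CollectI conjI bexI[of _ "tprefix n t"] bexI[of _ "tprefix n (tsuffix n t)"])
      (simp_all add: tprefix_def)
qed

text \<open>The translating element is the first \<open>n\<close> entries of the valuation. Its
  product with \<open>x\<close> is definable as the third component of a point of the multiplication
  graph.\<close>

lemma dfam_translate:
  assumes G: "definable_abelian_group L M n G" and Y: "dfam n (\<lambda>_. Y)" "Y \<subseteq> carrier G"
  shows "dfam n (\<lambda>v. {x \<in> carrier G. tprefix n v \<in> carrier G \<and> x \<otimes>\<^bsub>G\<^esub> tprefix n v \<in> Y})"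
proof -
  interpret comm_group G using G by (simp add: definable_abelian_group_def)
  have sub: "carrier G \<subseteq> tuples M n"
    using G by (auto simp: definable_abelian_group_def definable_def)
  have mg: "tprefix (3 * n) t \<in> mult_graph n G \<longleftrightarrow> tprefix n t \<in> carrier G \<and>
      tprefix n (tsuffix n t) \<in> carrier G \<and>
      tprefix n (tsuffix (2 * n) t) = tprefix n t \<otimes>\<^bsub>G\<^esub> tprefix n (tsuffix n t)" for t
    by (rule mult_graph_iff[OF sub]) (rule m_closed)
  have "dfn (\<lambda>v. tprefix (3 * n) v \<in> mult_graph n G)"
    using G by (intro dfn_if_definable) (simp add: definable_abelian_group_def)
  then have "dfn (\<lambda>w. tprefix n (tsuffix n w) \<in> carrier G \<and>
    tprefix n (tsuffix n (tsuffix n w)) \<in> carrier G \<and>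
    tprefix n w = tprefix n (tsuffix n w) \<otimes>\<^bsub>G\<^esub> tprefix n (tsuffix n (tsuffix n w)))"
  \<comment> \<open>Here \<open>w\<close> lists the product, then \<open>x\<close>, then the
    translating element; the graph expects the product last.\<close>
  proof (rule dfn_subst[where \<rho> = "\<lambda>w i. if i < 2 * n then w (n + i) else w (i - 2 * n)"])
    show "cterm (\<lambda>w. if i < 2 * n then w (n + i) else w (i - 2 * n))" for i
      by (intro cterm_if) auto
    fix w :: "nat \<Rightarrow> 'a"
    let ?t = "\<lambda>i. if i < 2 * n then w (n + i) else w (i - 2 * n)"
    have "tprefix n ?t = tprefix n (tsuffix n w)"
      "tprefix n (tsuffix n ?t) = tprefix n (tsuffix n (tsuffix n w))"
      "tprefix n (tsuffix (2 * n) ?t) = tprefix n w"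
      by (auto simp: tprefix_def tsuffix_def fun_eq_iff)
    then show "(tprefix n (tsuffix n w) \<in> carrier G \<and>
      tprefix n (tsuffix n (tsuffix n w)) \<in> carrier G \<and>
      tprefix n w = tprefix n (tsuffix n w) \<otimes>\<^bsub>G\<^esub> tprefix n (tsuffix n (tsuffix n w))) \<longleftrightarrow>
      tprefix (3 * n) ?t \<in> mult_graph n G" using mg[of ?t] by (simp only:)
  qed
  then have "dfn (\<lambda>w. tprefix n w \<in> Y \<and> (tprefix n (tsuffix n w) \<in> carrier G \<and>
    tprefix n (tsuffix n (tsuffix n w)) \<in> carrier G \<and>
    tprefix n w = tprefix n (tsuffix n w) \<otimes>\<^bsub>G\<^esub> tprefix n (tsuffix n (tsuffix n w))))"
    by (rule dfn_conj[OF Y(1)[unfolded dfam_def]])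
  then have "dfn (\<lambda>w. \<exists>z\<in>tuples M n. z \<in> Y \<and> (tprefix n w \<in> carrier G \<and>
    tprefix n (tsuffix n w) \<in> carrier G \<and> z = tprefix n w \<otimes>\<^bsub>G\<^esub> tprefix n (tsuffix n w)))"
    by (rule dfn_ex)
  then show ?thesis unfolding dfam_def
    by (rule dfn_cong) (use Y(2) sub in blast)
qed

section \<open>The contradiction from an indiscrete canonical topology\<close>

lemma canonical_topology_nontrivial:
  fixes G :: "(nat \<Rightarrow> 'a) monoid" (structure)
  assumes G: "definable_abelian_group L M n G" and can: "is_canonical_topology L M \<tau> n G \<sigma>"
    and two: "\<exists>x\<in>carrier G. \<exists>y\<in>carrier G. x \<noteq> y"
  shows "\<exists>U. openin \<sigma> U \<and> U \<noteq> {} \<and> U \<noteq> carrier G"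
proof (rule ccontr)
  assume triv: "\<not> ?thesis"
  interpret comm_group G using G by (simp add: definable_abelian_group_def)
  have sub: "carrier G \<subseteq> tuples M n"
    using G by (auto simp: definable_abelian_group_def definable_def)
  have dG: "dfam n (\<lambda>_. carrier G)"
    using G by (intro dfam_definable) (simp add: definable_abelian_group_def)
  \<comment> \<open>The interior of the difference set is open and contains the neutral element, so
    it is all of \<open>G\<close>.\<close>
  have diff: "carrier G \<subseteq> difference_set G X" if "big L M \<tau> n G X" for X
  proof -
    have "\<one> \<in> \<sigma> interior_of difference_set G X"
      using can that unfolding is_canonical_topology_def neighborhood_basis_at_def by blast
    then have "\<sigma> interior_of difference_set G X = carrier G" using triv openin_interior_of by blast
    then show ?thesis by (metis interior_of_subset)
  qed
  define d where "d = Max (proj_dims \<tau> n (carrier G))"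
  have "d \<in> proj_dims \<tau> n (carrier G)"
    unfolding d_def using zero_in_proj_dims[of "carrier G" \<tau> n] by (intro Max_in finite_proj_dims) auto
  \<comment> \<open>One projection witnessing the dimension of \<open>G\<close> is fixed for the
    whole proof. A set with solid image under it is big, and images can be compared in a single
    power of the model.\<close>
  then obtain s where s: "strict_mono_on {..<d} s" "s ` {..<d} \<subseteq> {..<n}" "d \<le> n"
    and solid: "tsolid \<tau> d (coord_proj d s ` carrier G)"
    unfolding proj_dims_def mem_Collect_eq by (elim conjE exE)
  have bigI: "big L M \<tau> n G X" if "dfam n (\<lambda>_. X)" "X \<subseteq> carrier G" "X \<noteq> {}"
    "tsolid \<tau> d (coord_proj d s ` X)" for X
  proof -
    have "d \<in> proj_dims \<tau> n X"
      unfolding proj_dims_def mem_Collect_eq using s that(4) by (intro conjI exI[of _ s])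
    then have "Max (proj_dims \<tau> n (carrier G)) \<in> proj_dims \<tau> n X" by (simp only: d_def)
    then show ?thesis
      unfolding big_def using that sub
      by (intro conjI dim_eq_if_proj_dims definable_dfam) auto
  qed
  obtain c where c: "c \<in> carrier M" using carrier_ne by blast
  have envG: "tjoin n g (\<lambda>_. c) \<in> env" "tprefix n (tjoin n g (\<lambda>_. c)) = g" if "g \<in> carrier G" for g
    using env_tjoin[of g n "\<lambda>_. c"] tprefix_tjoin[OF tuples_ext[of g M n]] subsetD[OF sub that] c
    by (simp_all add: env_def)
  have trans: "dfam n (\<lambda>_. {x \<in> carrier G. x \<otimes> g \<in> Y})"
    if "dfam n (\<lambda>_. Y)" "Y \<subseteq> carrier G" "g \<in> carrier G" for Y g
    using dfam_const[OF dfam_translate[OF G that(1,2)] envG(1)[OF that(3)]] envG(2)[OF that(3)] that(3)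
    by simp
  have move: "dfam n (\<lambda>_. {x \<in> X. x \<otimes> g \<notin> X})"
    if "dfam n (\<lambda>_. X)" "X \<subseteq> carrier G" "g \<in> carrier G" for X g
  proof -
    have "{x \<in> X. x \<otimes> g \<notin> X} = X - {x \<in> carrier G. x \<otimes> g \<in> X}" using that(2) by blast
    then show ?thesis using dfam_Diff[OF that(1) trans[OF that]] by simp
  qed
  \<comment> \<open>Otherwise the set is big and \<open>g\<close> is a difference of two of its
    points \<open>x\<close> and \<open>y\<close>. Then translating \<open>y\<close> by
    \<open>g\<close> gives \<open>x\<close>, which lies in \<open>X\<close>, contrary to the choice
    of \<open>y\<close>.\<close>
  have thin: "\<not> tsolid \<tau> d (coord_proj d s ` {x \<in> X. x \<otimes> g \<notin> X})"
    if X: "dfam n (\<lambda>_. X)" "X \<subseteq> carrier G" and g: "g \<in> carrier G" for X g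
  proof
    let ?X = "{x \<in> X. x \<otimes> g \<notin> X}"
    assume *: "tsolid \<tau> d (coord_proj d s ` ?X)"
    have "?X \<noteq> {}" using tsolid_point[OF *] by blast
    then have "big L M \<tau> n G ?X" using X(2) by (intro bigI move * X g) auto
    then have "g \<in> difference_set G ?X" using diff g by blast
    then obtain x y where xy: "x \<in> ?X" "y \<in> ?X" "g = x \<otimes> inv y" unfolding difference_set_def by blast
    then have "x \<in> carrier G" "y \<in> carrier G" using X(2) by auto
    then have "y \<otimes> g = x" using xy(3) by (simp add: m_comm[of x] m_assoc[symmetric])
    then show False using xy by simp
  qed
  show False
  proof (cases "d = 0")
    case True
    obtain x y where xy: "x \<in> carrier G" "y \<in> carrier G" "x \<noteq> y" using two by blast
    have "dfam n (\<lambda>_. {x})"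
    proof -
      have "dfn (\<lambda>w. \<forall>i\<in>{..<n}. w i = x i)"
        using xy(1) sub by (intro dfn_ball dfn_eq) (auto simp: tuples_def PiE_def)
      moreover have "tprefix n w = x \<longleftrightarrow> (\<forall>i\<in>{..<n}. w i = x i)" for w
        using tuples_ext[of x M n] xy(1) sub by (auto simp: tprefix_def fun_eq_iff extensional_def)
      ultimately show ?thesis unfolding dfam_def by simp
    qed
    \<comment> \<open>In dimension 0 a single point is big, although its difference set contains
      only the neutral element.\<close>
    moreover have "dim \<tau> n {x} = dim \<tau> n (carrier G)"
      using xy(1) True zero_in_proj_dims[of "{x}" \<tau> n]
      by (intro dim_eq_if_proj_dims) (auto simp: d_def[symmetric])
    ultimately have "big L M \<tau> n G {x}"
      unfolding big_def using xy(1) sub by (auto intro: definable_dfam)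
    from diff[OF this] have "carrier G \<subseteq> {\<one>}" using xy(1) by (auto simp: difference_set_def)
    then show False using xy by blast
  next
    case False
    then have s0: "s 0 < n" using s(2) by auto
    obtain U where U: "\<And>i. i < d \<Longrightarrow> openin \<tau> (U i) \<and> U i \<noteq> {}"
      "(\<Pi>\<^sub>E i\<in>{..<d}. U i) \<subseteq> coord_proj d s ` carrier G"
      using solid unfolding tsolid_def by blast
    have "infinite (U 0)" using U(1)[of 0] False infinite_open by blast
    then obtain a where a: "a \<in> U 0" "infinite (U 0 - {a})"
      using infinite_imp_nonempty[of "U 0"] by auto
    then obtain b where ab: "a \<in> U 0" "b \<in> U 0" "a \<noteq> b"
      using infinite_imp_nonempty[OF a(2)] by auto
    have U0: "openin \<tau> (U 0)" using U(1)[of 0] False by blast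
    then obtain V W where VW: "openin \<tau> V" "openin \<tau> W" "a \<in> V" "b \<in> W" "disjnt V W"
      using hausdorff ab openin_subset[OF U0] unfolding Hausdorff_space_def by (metis subsetD)
    obtain p where p: "p \<in> tuples M m" "a \<in> B p" "B p \<subseteq> U 0 \<inter> V"
      using basis_B[of "U 0 \<inter> V" a] VW U0 ab by auto
    obtain q where q: "q \<in> tuples M m" "b \<in> B q" "B q \<subseteq> U 0 \<inter> W"
      using basis_B[of "U 0 \<inter> W" b] VW U0 ab by auto
    \<comment> \<open>The first projected coordinate is \<open>s 0\<close>. Restricting it to the
      disjoint sets \<open>B p\<close> and \<open>B q\<close> inside \<open>U 0\<close> leaves open
      boxes in the projections, so both parts of \<open>G\<close> are big.\<close>
    define X where "X = (\<lambda>p. {x \<in> carrier G. x (s 0) \<in> B p})"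
    have XG: "X p \<subseteq> carrier G" for p by (auto simp: X_def)
    have dX: "dfam n (\<lambda>_. X p)" if "p \<in> tuples M m" for p
    proof -
      have "dfn (\<lambda>w. tprefix n w \<in> carrier G \<and> w (s 0) \<in> B (tprefix m p))"
        using that by (intro dfn_conj dG[unfolded dfam_def] dfn_mem_B) (auto simp: tuples_def PiE_def)
      moreover have "tprefix m p = p"
        using tuples_ext[OF that] by (auto simp: tprefix_def fun_eq_iff extensional_def)
      ultimately show ?thesis using s0 by (simp add: dfam_def X_def tprefix_def)
    qed
    have boxX: "(\<Pi>\<^sub>E i\<in>{..<d}. (U(0 := B p)) i) \<subseteq> coord_proj d s ` X p" if "B p \<subseteq> U 0" for p
    proof
      fix z assume z: "z \<in> (\<Pi>\<^sub>E i\<in>{..<d}. (U(0 := B p)) i)"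
      have "(\<Pi>\<^sub>E i\<in>{..<d}. (U(0 := B p)) i) \<subseteq> (\<Pi>\<^sub>E i\<in>{..<d}. U i)"
        using that by (intro PiE_mono) auto
      from subsetD[OF U(2) subsetD[OF this z]]
      obtain x where x: "x \<in> carrier G" "z = coord_proj d s x" by (elim imageE)
      have "z 0 \<in> B p" using PiE_mem[OF z, of 0] False by simp
      then show "z \<in> coord_proj d s ` X p" using x False by (auto simp: X_def coord_proj_def)
    qed
    have openX: "openin \<tau> ((U(0 := B p)) i) \<and> (U(0 := B p)) i \<noteq> {}"
      if "p \<in> tuples M m" "B p \<noteq> {}" "i < d" for p i
      using U(1)[OF that(3)] openin_B[OF that(1)] that(2) by simp
    have disj: "X p \<inter> X q = {}" using p q VW(5) by (auto simp: X_def disjnt_def)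
    define D where "D = (\<lambda>v. coord_proj d s ` (X p \<inter>
      {x \<in> carrier G. tprefix n v \<in> carrier G \<and> x \<otimes> tprefix n v \<in> X q}))"
    have dD: "dfam d D"
      unfolding D_def
      by (rule dfam_proj[OF dfam_Int[OF dX[OF p(1)] dfam_translate[OF G dX[OF q(1)] XG]] _ s(2)])
        (use XG[of p] sub in blast)
    \<comment> \<open>A point of \<open>X p\<close> that is moved into \<open>X q\<close> leaves
      \<open>X p\<close>, as the two are disjoint, so \<open>thin\<close> applies.\<close>
    have thinD: "\<not> tsolid \<tau> d (D v)" if "v \<in> env" for v
    proof (cases "tprefix n v \<in> carrier G")
      case True
      have "D v \<subseteq> coord_proj d s ` {x \<in> X p. x \<otimes> tprefix n v \<notin> X p}"
        unfolding D_def using disj by (intro image_mono) blast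
      then show ?thesis using thin[OF dX[OF p(1)] XG True] tsolid_mono by blast
    next
      case False
      then have "D v = {}" by (simp add: D_def)
      then show ?thesis using tsolid_point[of d "D v"] by auto
    qed
    define U' where "U' = U(0 := B p)"
    have U': "openin \<tau> (U' i) \<and> U' i \<noteq> {}" if "i < d" for i
      unfolding U'_def using p(2) by (intro openX[OF p(1) _ that]) blast
    have boxU': "(\<Pi>\<^sub>E i\<in>{..<d}. U' i) \<subseteq> coord_proj d s ` X p"
      unfolding U'_def using p(3) by (intro boxX) blast
    obtain F where F: "finite F" "F \<subseteq> (\<Pi>\<^sub>E i\<in>{..<d}. U' i)" "\<And>v. v \<in> env \<Longrightarrow> \<not> F \<subseteq> D v"
      by (rule finite_escape[OF dD thinD U']) auto
    \<comment> \<open>The escaping set \<open>F\<close> lies in the projection of \<open>X p\<close>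
      and is lifted to finitely many elements of the group.\<close>
    obtain S where S: "S \<subseteq> X p" "finite S" "F = coord_proj d s ` S"
      using finite_subset_image[OF F(1) subset_trans[OF F(2) boxU']] by blast
    have SG: "S \<subseteq> carrier G" using S(1) XG by blast
    \<comment> \<open>The points of \<open>X q\<close> that some element of \<open>S\<close> moves
      out of \<open>X q\<close>. Being a finite union of sets covered by \<open>thin\<close>, this
      set has thin projection by \<open>tsolid_Un\<close>.\<close>
    let ?Y = "\<lambda>S. (\<Union>g\<in>S. {y \<in> X q. y \<otimes> g \<notin> X q})"
    have "dfam n (\<lambda>_. ?Y S) \<and> \<not> tsolid \<tau> d (coord_proj d s ` ?Y S)"
      using S(2) SG
    proof (induction S)
      case empty
      have "\<not> tsolid \<tau> d {}" using tsolid_point[of d "{}"] by auto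
      then show ?case by (simp add: dfam_def)
    next
      case (insert g S)
      let ?Z = "{y \<in> X q. y \<otimes> g \<notin> X q}"
      have g: "g \<in> carrier G" and IH: "dfam n (\<lambda>_. ?Y S)" "\<not> tsolid \<tau> d (coord_proj d s ` ?Y S)"
        using insert by auto
      have Z: "dfam n (\<lambda>_. ?Z)" "\<not> tsolid \<tau> d (coord_proj d s ` ?Z)"
        using move[OF dX[OF q(1)] XG g] thin[OF dX[OF q(1)] XG g] .
      have "dfam d (\<lambda>_. coord_proj d s ` ?Z)" "dfam d (\<lambda>_. coord_proj d s ` ?Y S)"
        by (rule dfam_proj[OF Z(1) _ s(2)] dfam_proj[OF IH(1) _ s(2)];
          use XG[of q] sub in blast)+
      from tsolid_Un[OF this] Z(2) IH(2)
      have "\<not> tsolid \<tau> d (coord_proj d s ` (?Z \<union> ?Y S))" by (auto simp: image_Un)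
      then show ?case using dfam_Un[OF Z(1) IH(1)] by simp
    qed
    moreover have "tsolid \<tau> d (coord_proj d s ` X q)"
      unfolding tsolid_def
    proof (intro exI conjI allI impI)
      show "openin \<tau> ((U(0 := B q)) i)" "(U(0 := B q)) i \<noteq> {}" if "i < d" for i
        using openX[OF q(1) _ that] q(2) by blast+
      show "(\<Pi>\<^sub>E i\<in>{..<d}. (U(0 := B q)) i) \<subseteq> coord_proj d s ` X q"
        using q(3) by (intro boxX) blast
    qed
    \<comment> \<open>The projection of \<open>X q\<close> is solid and that of \<open>?Y S\<close>
      is not, so \<open>X q\<close> has a point outside \<open>?Y S\<close>.\<close>
    ultimately obtain y where y: "y \<in> X q" "\<And>g. g \<in> S \<Longrightarrow> y \<otimes> g \<in> X q"
      using tsolid_mono[of \<tau> d "coord_proj d s ` X q" "coord_proj d s ` ?Y S"] by blast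
    have yG: "y \<in> carrier G" using y(1) XG by blast
    \<comment> \<open>Commutativity exchanges the roles: \<open>y\<close> now translates all of
      \<open>S\<close> into \<open>X q\<close>, so \<open>F\<close> is contained in the member of
      the family \<open>D\<close> given by \<open>y\<close>.\<close>
    have "g \<otimes> y \<in> X q" if "g \<in> S" for g
      using y(2)[OF that] m_comm[of g y] yG SG that by auto
    then have "F \<subseteq> D (tjoin n y (\<lambda>_. c))"
      unfolding S(3) D_def envG(2)[OF yG] using S(1) SG yG by (intro image_mono) blast
    then show False using F(3)[OF envG(1)[OF yG]] by blast
  qed
qed

end

theorem theorem10p18:
  fixes L :: "('f, 'r) language"
    and T :: "('f, 'r) fm set"
    and \<T> :: "('a, 'f, 'r) fo_struct \<Rightarrow> 'a topology"
    and \<kappa> :: "'k rel"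
    and \<MM> :: "('a, 'f, 'r) fo_struct"
    and n :: nat
    and G :: "(nat \<Rightarrow> 'a) monoid"
    and \<tau> :: "(nat \<Rightarrow> 'a) topology"
  assumes "complete_theory TYPE('a) L T"
    and "t_minimal_by L T \<T>"
    and "monster_model L T \<kappa> \<MM>"
    and "definable_abelian_group L \<MM> n G"
    and "is_canonical_topology L \<MM> (\<T> \<MM>) n G \<tau>"
    and "\<exists>x\<in>carrier G. \<exists>y\<in>carrier G. x \<noteq> y"
  shows "\<exists>U. openin \<tau> U \<and> U \<noteq> {} \<and> U \<noteq> carrier G"
proof -
  obtain m B where "tame_model L \<MM> (\<T> \<MM>) m B"
    using tame_model_of_monster[OF assms(2,3)] by blast
  from tame_model.canonical_topology_nontrivial[OF this assms(4-6)] show ?thesis .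
qed

end
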